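(* Let $D\subseteq\mathbb{R}^k$ be an open set with $0\in D$, let $\Omega,S\subseteq D$ with $0\in\Omega$, $0\in S$, let $h:D\to\mathbb{R}^m$ be continuous with $h(0)=0$, and let $f:D\times D\times D\to\mathbb{R}^k$ be locally Lipschitz. For $n\in\mathbb{N}$ let $(\Sigma_n)$ be the string $\dot x_i=f(x_{i-1},x_i,x_{i+1})$, $y_i=h(x_i)$, $i=1,\dots,n$, with $x_0=u\in\Omega$, $x_{n+1}=w\in S$. Suppose that $(\Sigma_n)$ is forward complete for every $n\in\mathbb{N}$. Let $p\in[1,+\infty)$ and suppose that there exist $V\in C^1(D;\mathbb{R}_+)$, $g,r\in C^0(D^2;\mathbb{R})$ and constants $\sigma,\omega,\Gamma_1,\Gamma_2\ge0$, $c>0$ such that $$\nabla V(x)f(u,x,w)\le -c|h(x)|^p+g(u,x)+r(x,w)\quad\text{for all }x,u,w\in D,$$ $$r(x,w)+g(x,w)\le c\sigma|h(x)|^p+c\omega|h(w)|^p\quad\text{for all }x,w\in D,$$ $$g(u,x)\le\Gamma_1|h(u)|^p+c\omega|h(x)|^p\quad\text{for all }x\in D,\ u\in\Omega,$$ $$r(x,w)\le c\sigma|h(x)|^p+\Gamma_2|h(w)|^p\quad\text{for all }x\in D,\ w\in S.$$ If $\sigma+\omega<1$, then the string $(\Sigma_n)_{n\in\mathbb{N}}$ is $L^p$ string stable; moreover, the string stability estimate $$\|y_i\|_{[0,t],p}\le a_1\left(\|h(u)\|_{[0,t],p}\right)+a_2\left(\|h(w)\|_{[0,t],p}\right)+Q_n(\xi)$$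 (for all $n\in\mathbb{N}$, $\xi\in D^n$, $u\in\mho(\Omega)$, $w\in\mho(S)$, $t\ge0$, $i=1,\dots,n$, along the solution of $(\Sigma_n)$ with $x(0)=\xi$) holds with $$a_1(s)=\left(\frac{\Gamma_1}{c(1-\sigma-\omega)}\right)^{1/p}s,\qquad a_2(s)=\left(\frac{\Gamma_2}{c(1-\sigma-\omega)}\right)^{1/p}s\quad\text{for all }s\ge0,$$ $$Q_n(\xi_1,\dots,\xi_n)=\left(\frac{1}{c(1-\sigma-\omega)}\sum_{i=1}^nV(\xi_i)\right)^{1/p}\quad\text{for all }(\xi_1,\dots,\xi_n)\in D^n.$$ Finally, if (i) for every $\rho>0$ the set $\{\xi\in D:V(\xi)\le\rho,\ |\xi|\le\rho\}$ is compact (in the standard topology of $\mathbb{R}^k$), and (ii) for every pair of compact sets $\bar\Omega\subseteq\Omega$, $\bar S\subseteq S$ and every $\rho>0$, the sets $f(\Phi_\rho\times\Phi_\rho\times\Phi_\rho)$, $f(\bar\Omega\times\Phi_\rho\times\Phi_\rho)$, $f(\Phi_\rho\times\Phi_\rho\times\bar S)$ are bounded, where $\Phi_\rho=\{\xi\in D:V(\xi)\le\rho\}$, then the assumption that $(\Sigma_n)$ is forward complete for every $n\in\mathbb{N}$ is not needed (that is, if $\sigma+\omega<1$, then without assuming forward completeness the string $(\Sigma_n)_{n\in\mathbb{N}}$ is still $L^p$ string stable, and the estimate $\|y_i\|_{[0,t],p}\le a_1(\|h(u)\|_{[0,t],p})+a_2(\|h(w)\|_{[0,t],p})+Q_n(\xi)$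 still holds with $a_1(s)=\left(\frac{\Gamma_1}{c(1-\sigma-\omega)}\right)^{1/p}s$, $a_2(s)=\left(\frac{\Gamma_2}{c(1-\sigma-\omega)}\right)^{1/p}s$ and $Q_n(\xi_1,\dots,\xi_n)=\left(\frac{1}{c(1-\sigma-\omega)}\sum_{i=1}^nV(\xi_i)\right)^{1/p}$).
   Context: Notation. $\mathbb{R}_+=[0,+\infty)$, $|\cdot|$ is the Euclidean norm, and $\nabla V(x)=\left(\frac{\partial V}{\partial x_1}(x),\dots,\frac{\partial V}{\partial x_k}(x)\right)$ is a row vector. For a set $A\subseteq\mathbb{R}^q$, $\mho(A)$ is the set of Lebesgue measurable, locally essentially bounded functions $u:\mathbb{R}_+\to A$ such that for every $T>0$ there is a compact set $\Omega_T\subseteq A$ with $u(t)\in\Omega_T$ for almost every $t\in[0,T]$. For a locally essentially bounded measurable signal $y$ on $\mathbb{R}_+$, $t\ge0$ and $p\in[1,+\infty)$: $\|y\|_{[0,t],p}=\left(\int_0^t|y(s)|^p\,ds\right)^{1/p}$. Forward completeness. The state of $(\Sigma_n)$ is $x=(x_1,\dots,x_n)\in D^n$. The system $(\Sigma_n)$ is forward complete if for every $\xi\in D^n$, $u\in\mho(\Omega)$, $w\in\mho(S)$ the (unique, Carathéodory) solution $x(t)\in D^n$ with $x(0)=\xi$ exists for all $t\ge 0$. $L^p$ string stability. The string $(\Sigma_n)_{n\in\mathbb{N}}$ is $L^p$ string stable if there exist non-decreasing functions $a_1,a_2\in C^0(\mathbb{R}_+;\mathbb{R}_+)$, independent of $n$,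 such that for every $n\in\mathbb{N}$: (i) $(\Sigma_n)$ is forward complete, and (ii) there exists $Q_n\in C^0(D^n;\mathbb{R}_+)$ such that for every $\xi\in D^n$, $u\in\mho(\Omega)$, $w\in\mho(S)$ the solution of $(\Sigma_n)$ with $x(0)=\xi$ satisfies, for all $t\ge0$ and $i=1,\dots,n$, $\|y_i\|_{[0,t],p}\le a_1(\|h(u)\|_{[0,t],p})+a_2(\|h(w)\|_{[0,t],p})+Q_n(\xi)$. *)

theory Defs
  imports "HOL-Analysis.Analysis"
begin

text \<open>Signals and trajectories are total functions on the reals; only their values at times
  \<open>t \<ge> 0\<close> matter.\<close>

definition locally_ess_bounded :: "(real \<Rightarrow> 'a::real_normed_vector) \<Rightarrow> bool" where
  "locally_ess_bounded u \<longleftrightarrow>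
     (\<forall>T>0. \<exists>M. AE t in lebesgue_on {0..T}. norm (u t) \<le> M)"

definition signals :: "'a::euclidean_space set \<Rightarrow> (real \<Rightarrow> 'a) set" where
  "signals A = {u. (\<forall>t\<ge>0. u t \<in> A)
     \<and> u \<in> borel_measurable (lebesgue_on {0..})
     \<and> locally_ess_bounded u
     \<and> (\<forall>T>0. \<exists>K. compact K \<and> K \<subseteq> A \<and> (AE t in lebesgue_on {0..T}. u t \<in> K))}"

definition Lp_norm :: "real \<Rightarrow> real \<Rightarrow> (real \<Rightarrow> 'a::euclidean_space) \<Rightarrow> real" where
  "Lp_norm p t y = (\<integral>s. norm (y s) powr p \<partial>lebesgue_on {0..t}) powr (1 / p)"

definition locally_lipschitz_on ::
    "'a::metric_space set \<Rightarrow> ('a \<Rightarrow> 'b::metric_space) \<Rightarrow> bool" where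
  "locally_lipschitz_on X f \<longleftrightarrow>
     (\<forall>x\<in>X. \<exists>e>0. \<exists>L. lipschitz_on L (cball x e \<inter> X) f)"

definition gradient :: "(real ^ 'k \<Rightarrow> real) \<Rightarrow> real ^ 'k \<Rightarrow> real ^ 'k" where
  "gradient V x = (\<chi> i. deriv (\<lambda>s. V (x + s *\<^sub>R axis i 1)) 0)"

definition C1_on :: "(real ^ 'k) set \<Rightarrow> (real ^ 'k \<Rightarrow> real) \<Rightarrow> bool" where
  "C1_on D V \<longleftrightarrow> (\<forall>x\<in>D. V differentiable (at x)) \<and> continuous_on D (gradient V)"

text \<open>The usual epsilon-delta notion: \<open>P division_of A\<close> says that \<open>P\<close> is a finite family of
  non-overlapping compact intervals with union \<open>A\<close>.\<close>

definition absolutely_continuous_on :: "real set \<Rightarrow> (real \<Rightarrow> 'a::real_normed_vector) \<Rightarrow> bool" where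
  "absolutely_continuous_on S x \<longleftrightarrow>
     (\<forall>e>0. \<exists>d>0. \<forall>P A. P division_of A \<and> A \<subseteq> S \<and> (\<Sum>K\<in>P. Sup K - Inf K) < d
        \<longrightarrow> (\<Sum>K\<in>P. norm (x (Sup K) - x (Inf K))) < e)"

text \<open>\<open>D\<^sup>n\<close>, with components indexed by \<open>1, \<dots>, n\<close>. The functions in this set are fixed
  outside of \<open>{1..n}\<close>, and the product topology on functions induces the topology of \<open>D\<^sup>n\<close>.\<close>

abbreviation Dpow :: "'a set \<Rightarrow> nat \<Rightarrow> (nat \<Rightarrow> 'a) set" where
  "Dpow D n \<equiv> PiE {1..n} (\<lambda>_. D)"

text \<open>The string together with its boundary inputs, \<open>x\<^sub>0 = u\<close> and \<open>x\<^sub>n\<^sub>+\<^sub>1 = w\<close>.\<close>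

definition with_boundary ::
    "nat \<Rightarrow> (real \<Rightarrow> 'a) \<Rightarrow> (real \<Rightarrow> 'a) \<Rightarrow> (real \<Rightarrow> nat \<Rightarrow> 'a) \<Rightarrow> real \<Rightarrow> nat \<Rightarrow> 'a" where
  "with_boundary n u w x t j = (if j = 0 then u t else if j = n + 1 then w t else x t j)"

text \<open>A global Caratheodory solution, that is, one defined for all \<open>t \<ge> 0\<close>.\<close>

definition string_solution ::
    "(real ^ 'k) set \<Rightarrow> ((real ^ 'k) \<times> (real ^ 'k) \<times> (real ^ 'k) \<Rightarrow> real ^ 'k) \<Rightarrow> nat \<Rightarrow>
     (real \<Rightarrow> real ^ 'k) \<Rightarrow> (real \<Rightarrow> real ^ 'k) \<Rightarrow> (nat \<Rightarrow> real ^ 'k) \<Rightarrow>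
     (real \<Rightarrow> nat \<Rightarrow> real ^ 'k) \<Rightarrow> bool" where
  "string_solution D f n u w \<xi> x \<longleftrightarrow>
     x 0 = \<xi>
     \<and> (\<forall>t\<ge>0. x t \<in> Dpow D n)
     \<and> (\<forall>i\<in>{1..n}. \<forall>T>0. absolutely_continuous_on {0..T} (\<lambda>t. x t i))
     \<and> (\<forall>i\<in>{1..n}. AE t in lebesgue_on {0..}.
          ((\<lambda>s. x s i) has_vector_derivative
             f (with_boundary n u w x t (i - 1),
                with_boundary n u w x t i,
                with_boundary n u w x t (i + 1))) (at t))"

text \<open>Uniqueness of the solution on \<open>t \<ge> 0\<close> is not part of the definition: it is automatic when \<open>f\<close>
  is locally Lipschitz.\<close>

definition forward_complete ::
    "(real ^ 'k) set \<Rightarrow> (real ^ 'k) set \<Rightarrow> (real ^ 'k) set \<Rightarrow>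
     ((real ^ 'k) \<times> (real ^ 'k) \<times> (real ^ 'k) \<Rightarrow> real ^ 'k) \<Rightarrow> nat \<Rightarrow> bool" where
  "forward_complete D \<Omega> S f n \<longleftrightarrow>
     (\<forall>\<xi>\<in>Dpow D n. \<forall>u\<in>signals \<Omega>. \<forall>w\<in>signals S. \<exists>x. string_solution D f n u w \<xi> x)"

definition stability_estimate ::
    "(real ^ 'k) set \<Rightarrow> (real ^ 'k) set \<Rightarrow> (real ^ 'k) set \<Rightarrow>
     ((real ^ 'k) \<times> (real ^ 'k) \<times> (real ^ 'k) \<Rightarrow> real ^ 'k) \<Rightarrow> (real ^ 'k \<Rightarrow> real ^ 'm) \<Rightarrow>
     real \<Rightarrow> nat \<Rightarrow> (real \<Rightarrow> real) \<Rightarrow> (real \<Rightarrow> real) \<Rightarrow> ((nat \<Rightarrow> real ^ 'k) \<Rightarrow> real) \<Rightarrow> bool" where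
  "stability_estimate D \<Omega> S f h p n a\<^sub>1 a\<^sub>2 Q \<longleftrightarrow>
     (\<forall>\<xi>\<in>Dpow D n. \<forall>u\<in>signals \<Omega>. \<forall>w\<in>signals S. \<forall>x. string_solution D f n u w \<xi> x \<longrightarrow>
        (\<forall>t\<ge>0. \<forall>i\<in>{1..n}.
           Lp_norm p t (\<lambda>s. h (x s i))
             \<le> a\<^sub>1 (Lp_norm p t (\<lambda>s. h (u s))) + a\<^sub>2 (Lp_norm p t (\<lambda>s. h (w s))) + Q \<xi>))"

definition Lp_string_stable ::
    "(real ^ 'k) set \<Rightarrow> (real ^ 'k) set \<Rightarrow> (real ^ 'k) set \<Rightarrow>
     ((real ^ 'k) \<times> (real ^ 'k) \<times> (real ^ 'k) \<Rightarrow> real ^ 'k) \<Rightarrow> (real ^ 'k \<Rightarrow> real ^ 'm) \<Rightarrow>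
     real \<Rightarrow> bool" where
  "Lp_string_stable D \<Omega> S f h p \<longleftrightarrow>
     (\<exists>a\<^sub>1 a\<^sub>2.
        continuous_on {0..} a\<^sub>1 \<and> mono_on {0..} a\<^sub>1 \<and> (\<forall>s\<ge>0. 0 \<le> a\<^sub>1 s)
        \<and> continuous_on {0..} a\<^sub>2 \<and> mono_on {0..} a\<^sub>2 \<and> (\<forall>s\<ge>0. 0 \<le> a\<^sub>2 s)
        \<and> (\<forall>n\<ge>1. forward_complete D \<Omega> S f n
             \<and> (\<exists>Q. continuous_on (Dpow D n) Q \<and> (\<forall>\<xi>\<in>Dpow D n. 0 \<le> Q \<xi>)
                   \<and> stability_estimate D \<Omega> S f h p n a\<^sub>1 a\<^sub>2 Q)))"

end

theory Submission
  imports Defs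
begin

text \<open>Along a solution, summing the dissipation inequalities over the string makes the coupling terms
  \<open>g\<close> and \<open>r\<close> telescope into \<open>c * (\<sigma> + \<omega>)\<close> times the total output plus boundary terms, so the
  total storage \<open>\<Sum>V (x\<^sub>i)\<close> decreases at rate \<open>c * (1 - \<sigma> - \<omega>) * \<Sum>|h (x\<^sub>i)|\<^sup>p\<close> up to the contribution of the
  two inputs. Integrating and using subadditivity of \<open>s powr (1 / p)\<close> gives the estimate. The same
  inequality bounds \<open>V\<close> along solutions on bounded time intervals; under (i) and (ii) this confines
  them to compact sets, which yields global existence.\<close>

section \<open>Absolutely continuous functions\<close>

text \<open>Inputs are only measurable and locally essentially bounded, so solutions satisfy the
  equation almost everywhere and the total storage is merely absolutely continuous; its derivative
  bound must be integrated across a negligible exceptional set, and an inequality is all that is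
  needed. The rate c (1 - \<sigma> - \<omega>) arises because every node receives one \<sigma>-term
  from its right link and one \<omega>-term from its left link. For global existence, the obstacle
  is that a priori bounds hold only for solutions that already exist, while \<open>f\<close> is
  Lipschitz only locally in \<open>D\<close>. The bounds come in an order that avoids circularity:
  the bound on \<open>V\<close> depends on initial data, horizon and inputs alone; it selects a
  sublevel set on which \<open>f\<close> is bounded by (ii); bounded speed over a finite horizon
  bounds the norm; and (i) turns the bounds on \<open>V\<close> and on the norm together into
  compactness inside \<open>D\<close>. Existence is proved for the integral form of the equation on
  each bounded interval, and uniqueness glues the pieces into a solution for all times.\<close>

lemma AE_lebesgue_on_iff_negligible:
  assumes "S \<in> sets lebesgue"
  shows "(AE t in lebesgue_on S. P t) \<longleftrightarrow> (\<exists>N. negligible N \<and> (\<forall>t\<in>S - N. P t))"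
proof -
  have "(AE t in lebesgue_on S. P t) \<longleftrightarrow> (AE t in lebesgue. t \<in> S \<longrightarrow> P t)"
    using assms by (simp add: AE_restrict_space_iff)
  also have "\<dots> \<longleftrightarrow> (\<exists>N. negligible N \<and> (\<forall>t\<in>S - N. P t))"
    by (auto simp: eventually_ae_filter negligible_iff_null_sets)
  finally show ?thesis .
qed

lemma lipschitz_imp_absolutely_continuous_on:
  fixes x :: "real \<Rightarrow> 'a::real_normed_vector"
  assumes "\<And>s t. s \<in> S \<Longrightarrow> t \<in> S \<Longrightarrow> s \<le> t \<Longrightarrow> norm (x t - x s) \<le> M * (t - s)"
  shows "absolutely_continuous_on S x"
  unfolding absolutely_continuous_on_def
proof (intro allI impI)
  fix e :: real assume "e > 0"
  \<comment> \<open>\<open>M\<close> may be zero or negative; \<open>B\<close> is strictly positive,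
    so that \<open>e / B\<close> is an admissible \<open>d\<close>.\<close>
  define B where "B = max M 0 + 1"
  have B: "B > 0" "M \<le> B" unfolding B_def by auto
  have "(\<Sum>K\<in>P. norm (x (Sup K) - x (Inf K))) < e"
    if P: "P division_of A" "A \<subseteq> S" and l: "(\<Sum>K\<in>P. Sup K - Inf K) < e / B" for P A
  proof -
    have "norm (x (Sup K) - x (Inf K)) \<le> B * (Sup K - Inf K)" if K: "K \<in> P" for K
    proof -
      obtain a b where ab: "K = cbox a b" "cbox a b \<noteq> {}" using division_ofD(3,4)[OF P(1) K] by metis
      then have *: "a \<le> b" "Sup K = b" "Inf K = a" by auto
      have "{a, b} \<subseteq> S" using division_ofD(2)[OF P(1) K] ab * P(2) by auto
      then have "norm (x b - x a) \<le> M * (b - a)" using assms * by auto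
      also have "\<dots> \<le> B * (b - a)" using B * by (intro mult_right_mono) auto
      finally show ?thesis using * by simp
    qed
    then have "(\<Sum>K\<in>P. norm (x (Sup K) - x (Inf K))) \<le> (\<Sum>K\<in>P. B * (Sup K - Inf K))"
      by (rule sum_mono)
    also have "\<dots> = B * (\<Sum>K\<in>P. Sup K - Inf K)" by (simp add: sum_distrib_left)
    also have "\<dots> < e" using l B by (simp add: field_simps)
    finally show ?thesis .
  qed
  then show "\<exists>d>0. \<forall>P A. P division_of A \<and> A \<subseteq> S \<and> (\<Sum>K\<in>P. Sup K - Inf K) < d
        \<longrightarrow> (\<Sum>K\<in>P. norm (x (Sup K) - x (Inf K))) < e"
    using \<open>e > 0\<close> B by (intro exI[of _ "e / B"]) auto
qed

lemma absolutely_continuous_on_subset: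
  "absolutely_continuous_on S x \<Longrightarrow> T \<subseteq> S \<Longrightarrow> absolutely_continuous_on T x"
  unfolding absolutely_continuous_on_def by (meson order_trans)

text \<open>A single interval is already a division, so testing the definition on
  \<open>cbox u v\<close> gives uniform continuity.\<close>

lemma absolutely_continuous_on_imp_continuous_on:
  fixes x :: "real \<Rightarrow> 'a::real_normed_vector"
  assumes "absolutely_continuous_on {a..b} x"
  shows "continuous_on {a..b} x"
  unfolding continuous_on_iff
proof (intro ballI allI impI)
  fix s e :: real assume s: "s \<in> {a..b}" and "e > 0"
  then obtain d where "d > 0" and d: "\<And>P A. P division_of A \<Longrightarrow> A \<subseteq> {a..b} \<Longrightarrow>
      (\<Sum>K\<in>P. Sup K - Inf K) < d \<Longrightarrow> (\<Sum>K\<in>P. norm (x (Sup K) - x (Inf K))) < e"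
    using assms unfolding absolutely_continuous_on_def by metis
  have *: "norm (x v - x u) < e" if "u \<le> v" "v - u < d" "u \<in> {a..b}" "v \<in> {a..b}" for u v
    using d[of "{cbox u v}" "cbox u v"] that division_of_self[of u v] by auto
  show "\<exists>d>0. \<forall>t\<in>{a..b}. dist t s < d \<longrightarrow> dist (x t) (x s) < e"
  proof (intro exI[of _ d] conjI ballI impI)
    fix t assume "t \<in> {a..b}" "dist t s < d"
    then show "dist (x t) (x s) < e"
      using *[of s t] *[of t s] s by (cases "s \<le> t") (auto simp: dist_norm norm_minus_commute)
  qed fact
qed

lemma absolutely_continuous_on_add:
  fixes x y :: "real \<Rightarrow> 'a::real_normed_vector"
  assumes "absolutely_continuous_on S x" "absolutely_continuous_on S y"
  shows "absolutely_continuous_on S (\<lambda>t. x t + y t)"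
  unfolding absolutely_continuous_on_def
proof (intro allI impI)
  fix e :: real assume "e > 0"
  then have "e/2 > 0" by simp
  obtain d where d: "d > 0" "\<And>P A. P division_of A \<Longrightarrow> A \<subseteq> S \<Longrightarrow>
      (\<Sum>K\<in>P. Sup K - Inf K) < d \<Longrightarrow> (\<Sum>K\<in>P. norm (x (Sup K) - x (Inf K))) < e/2"
    using assms(1) \<open>e/2 > 0\<close> unfolding absolutely_continuous_on_def by metis
  obtain d' where d': "d' > 0" "\<And>P A. P division_of A \<Longrightarrow> A \<subseteq> S \<Longrightarrow>
      (\<Sum>K\<in>P. Sup K - Inf K) < d' \<Longrightarrow> (\<Sum>K\<in>P. norm (y (Sup K) - y (Inf K))) < e/2"
    using assms(2) \<open>e/2 > 0\<close> unfolding absolutely_continuous_on_def by metis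
  have "(\<Sum>K\<in>P. norm (x (Sup K) + y (Sup K) - (x (Inf K) + y (Inf K)))) < e"
    if P: "P division_of A" "A \<subseteq> S" and l: "(\<Sum>K\<in>P. Sup K - Inf K) < min d d'" for P A
  proof -
    have "(\<Sum>K\<in>P. norm (x (Sup K) + y (Sup K) - (x (Inf K) + y (Inf K))))
      \<le> (\<Sum>K\<in>P. norm (x (Sup K) - x (Inf K)) + norm (y (Sup K) - y (Inf K)))"
      by (intro sum_mono) (simp add: add_diff_add norm_triangle_ineq)
    also have "\<dots> < e" using d(2)[OF P] d'(2)[OF P] l by (simp add: sum.distrib)
    finally show ?thesis .
  qed
  then show "\<exists>d>0. \<forall>P A. P division_of A \<and> A \<subseteq> S \<and> (\<Sum>K\<in>P. Sup K - Inf K) < d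
        \<longrightarrow> (\<Sum>K\<in>P. norm (x (Sup K) + y (Sup K) - (x (Inf K) + y (Inf K)))) < e"
    using d(1) d'(1) by (intro exI[of _ "min d d'"]) auto
qed

lemma absolutely_continuous_on_sum:
  fixes x :: "'i \<Rightarrow> real \<Rightarrow> 'a::real_normed_vector"
  assumes "\<And>i. i \<in> I \<Longrightarrow> absolutely_continuous_on S (x i)"
  shows "absolutely_continuous_on S (\<lambda>t. \<Sum>i\<in>I. x i t)"
  using assms
proof (induction I rule: infinite_finite_induct)
  case (insert i I)
  then show ?case by (auto intro: absolutely_continuous_on_add)
qed (auto intro!: lipschitz_imp_absolutely_continuous_on[where M=0])

text \<open>The Lipschitz estimate is applied to each interval of the division, with
  \<open>L + 1\<close> in place of \<open>L\<close> so that \<open>e\<close> can be divided by it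
  when \<open>L = 0\<close>. This carries \<open>V\<close> along a trajectory: \<open>V\<close> is
  Lipschitz only on compact sets, hence the set \<open>X\<close>.\<close>

lemma absolutely_continuous_on_lipschitz_compose:
  fixes x :: "real \<Rightarrow> 'a::real_normed_vector" and f :: "'a \<Rightarrow> 'b::real_normed_vector"
  assumes "absolutely_continuous_on S x" and lip: "lipschitz_on L X f" and X: "x ` S \<subseteq> X"
  shows "absolutely_continuous_on S (\<lambda>t. f (x t))"
  unfolding absolutely_continuous_on_def
proof (intro allI impI)
  fix e :: real assume "e > 0"
  have L: "0 \<le> L" using lip lipschitz_on_nonneg by blast
  then have "e / (L + 1) > 0" using \<open>e > 0\<close> by simp
  then obtain d where d: "d > 0" "\<And>P A. P division_of A \<Longrightarrow> A \<subseteq> S \<Longrightarrow>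
      (\<Sum>K\<in>P. Sup K - Inf K) < d \<Longrightarrow> (\<Sum>K\<in>P. norm (x (Sup K) - x (Inf K))) < e / (L + 1)"
    using assms(1) unfolding absolutely_continuous_on_def by metis
  have "(\<Sum>K\<in>P. norm (f (x (Sup K)) - f (x (Inf K)))) < e"
    if P: "P division_of A" "A \<subseteq> S" and l: "(\<Sum>K\<in>P. Sup K - Inf K) < d" for P A
  proof -
    have "norm (f (x (Sup K)) - f (x (Inf K))) \<le> (L + 1) * norm (x (Sup K) - x (Inf K))"
      if K: "K \<in> P" for K
    proof -
      obtain a b where ab: "K = cbox a b" "cbox a b \<noteq> {}" using division_ofD(3,4)[OF P(1) K] by metis
      then have *: "a \<le> b" "Sup K = b" "Inf K = a" by auto
      have "{a, b} \<subseteq> S" using division_ofD(2)[OF P(1) K] ab * P(2) by auto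
      then have "{x a, x b} \<subseteq> X" using X by auto
      then have "norm (f (x b) - f (x a)) \<le> L * norm (x b - x a)"
        using lipschitz_onD[OF lip, of "x b" "x a"] by (auto simp: dist_norm)
      also have "\<dots> \<le> (L + 1) * norm (x b - x a)" by (intro mult_right_mono) auto
      finally show ?thesis using * by simp
    qed
    then have "(\<Sum>K\<in>P. norm (f (x (Sup K)) - f (x (Inf K)))) \<le> (\<Sum>K\<in>P. (L + 1) * norm (x (Sup K) - x (Inf K)))"
      by (rule sum_mono)
    also have "\<dots> = (L + 1) * (\<Sum>K\<in>P. norm (x (Sup K) - x (Inf K)))" by (simp add: sum_distrib_left)
    also have "\<dots> < e" using d(2)[OF P l] L by (simp add: field_simps)
    finally show ?thesis .
  qed
  then show "\<exists>d>0. \<forall>P A. P division_of A \<and> A \<subseteq> S \<and> (\<Sum>K\<in>P. Sup K - Inf K) < d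
        \<longrightarrow> (\<Sum>K\<in>P. norm (f (x (Sup K)) - f (x (Inf K)))) < e"
    using d(1) by blast
qed

text \<open>The upper half of the straddle lemma: the differentiability estimates at
  \<open>u\<close> and at \<open>v\<close> add up because \<open>t - u\<close> and
  \<open>v - t\<close> have the same sign and the sum \<open>v - u\<close>.\<close>

lemma straddle_upper_bound:
  fixes F :: "real \<Rightarrow> real"
  assumes "(F has_real_derivative D) (at t)" "e > 0"
  obtains d where "d > 0"
    "\<And>u v. u \<le> t \<Longrightarrow> t \<le> v \<Longrightarrow> t - d < u \<Longrightarrow> v < t + d \<Longrightarrow> F v - F u \<le> (D + e) * (v - u)"
proof -
  have "(F has_derivative (\<lambda>h. h * D)) (at t)"
    using assms(1) by (simp add: has_field_derivative_def mult_commute_abs)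
  then obtain d where "d > 0" and d: "\<And>y. norm (y - t) < d \<Longrightarrow>
       norm (F y - F t - (y - t) * D) \<le> e * norm (y - t)"
    using assms(2) unfolding has_derivative_at_alt by blast
  have "F v - F u \<le> (D + e) * (v - u)" if "u \<le> t" "t \<le> v" "t - d < u" "v < t + d" for u v
    using d[of u] d[of v] that by (auto simp: algebra_simps abs_le_iff)
  then show thesis using that \<open>d > 0\<close> by blast
qed

text \<open>Cousin's lemma: intervals tagged outside the exceptional set obey the derivative bound, and
  those tagged in it have small total length, so that absolute continuity controls them.\<close>

lemma absolutely_continuous_diff_le_integral:
  fixes F F' \<phi> :: "real \<Rightarrow> real"
  assumes ab: "a \<le> b" and ac: "absolutely_continuous_on {a..b} F" and N: "negligible N"
    and der: "\<And>t. t \<in> {a<..<b} - N \<Longrightarrow> (F has_real_derivative F' t) (at t)"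
    and le: "\<And>t. t \<in> {a<..<b} - N \<Longrightarrow> F' t \<le> \<phi> t"
    and int: "\<phi> integrable_on {a..b}"
  shows "F b - F a \<le> integral {a..b} \<phi>"
proof (rule field_le_epsilon)
  fix \<epsilon> :: real assume "\<epsilon> > 0"
  \<comment> \<open>Error budget: one \<open>e\<close> for the Riemann sum, one for the intervals
    with exceptional tags, and \<open>e * (b - a)\<close> for the straddle estimates.\<close>
  define e where "e = \<epsilon> / (b - a + 2)"
  have "e > 0" using ab \<open>\<epsilon> > 0\<close> by (simp add: e_def)
  \<comment> \<open>The derivative is known only in the open interval, so the endpoints count as
    exceptional.\<close>
  define N' where "N' = N \<union> {a, b}"
  have N': "negligible N'" using N by (simp add: N'_def)
  \<comment> \<open>With value 0 on \<open>N'\<close>, exceptional tags do not enter the Riemann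
    sum, and a sum over \<open>p - q\<close> is at most the sum over all of \<open>p\<close>,
    whatever the sign of \<open>\<phi>\<close> there.\<close>
  define \<psi> where "\<psi> t = (if t \<in> N' then 0 else \<phi> t)" for t
  have "(\<psi> has_integral integral {a..b} \<phi>) {a..b}"
    by (rule has_integral_spike[OF N' _ integrable_integral[OF int]]) (simp add: \<psi>_def)
  then obtain \<gamma> where \<gamma>: "gauge \<gamma>" "\<And>p. p tagged_division_of {a..b} \<Longrightarrow> \<gamma> fine p \<Longrightarrow>
      norm ((\<Sum>(x,K)\<in>p. measure lborel K *\<^sub>R \<psi> x) - integral {a..b} \<phi>) < e"
    using \<open>e > 0\<close> unfolding has_integral_real by metis
  obtain d where "d > 0" and d: "\<And>P A. P division_of A \<Longrightarrow> A \<subseteq> {a..b} \<Longrightarrow>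
      (\<Sum>K\<in>P. Sup K - Inf K) < d \<Longrightarrow> (\<Sum>K\<in>P. norm (F (Sup K) - F (Inf K))) < e"
    using ac \<open>e > 0\<close> unfolding absolutely_continuous_on_def by metis
  \<comment> \<open>Outer regularity. The gauge \<open>G\<close> will force every interval with a
    tag in \<open>N'\<close> into \<open>U\<close>, so the total length of these intervals stays
    below the \<open>d\<close> of absolute continuity.\<close>
  obtain U where U: "open U" "N' \<subseteq> U" "U \<in> lmeasurable" "measure lebesgue U < d"
  proof -
    obtain U where U: "open U" "N' \<subseteq> U" "U - N' \<in> lmeasurable" "emeasure lebesgue (U - N') < ennreal d"
      using sets_lebesgue_outer_open[OF negligible_imp_sets[OF N'] \<open>d > 0\<close>] by metis
    then have "measure lebesgue (U - N') < d"
      using \<open>d > 0\<close> by (simp add: emeasure_eq_measure2 ennreal_less_iff)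
    moreover have "U \<in> lmeasurable" "measure lebesgue U = measure lebesgue (U - N')"
      using negligible_imp_measurable[OF N'] U N'
      by (auto simp: measure_Diff_null_set negligible_iff_null_sets dest: fmeasurable.Un)
        (metis Diff_partition Un_commute fmeasurable.Un)
    ultimately show thesis using that U by metis
  qed
  have "\<exists>\<delta>>0. t \<in> {a..b} - N' \<longrightarrow> (\<forall>u v. u \<le> t \<longrightarrow> t \<le> v \<longrightarrow> t - \<delta> < u \<longrightarrow> v < t + \<delta> \<longrightarrow>
      F v - F u \<le> (F' t + e) * (v - u))" for t
  proof (cases "t \<in> {a..b} - N'")
    case True
    then have "t \<in> {a<..<b} - N" by (auto simp: N'_def)
    from straddle_upper_bound[OF der[OF this] \<open>e > 0\<close>] show ?thesis by metis
  qed (auto intro: exI[of _ 1])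
  then obtain \<delta> where \<delta>: "\<And>t. \<delta> t > 0"
    "\<And>t u v. t \<in> {a..b} - N' \<Longrightarrow> u \<le> t \<Longrightarrow> t \<le> v \<Longrightarrow> t - \<delta> t < u \<Longrightarrow> v < t + \<delta> t \<Longrightarrow>
      F v - F u \<le> (F' t + e) * (v - u)"
    by metis
  define G where "G t = \<gamma> t \<inter> (if t \<in> N' then U else ball t (\<delta> t))" for t
  have "gauge G"
    using \<gamma>(1) U \<delta>(1) unfolding gauge_def G_def by auto
  then obtain p where p: "p tagged_division_of {a..b}" "G fine p"
    using fine_division_exists_real by blast
  have "\<gamma> fine p" using p(2) unfolding fine_def G_def by auto
  note pD = tagged_division_ofD[OF p(1)]
  have "finite p" by (rule pD(1))
  have K: "\<exists>u v. K = {u..v} \<and> u \<le> x \<and> x \<le> v \<and> a \<le> u \<and> v \<le> b \<and> measure lborel K = v - u \<and> Sup K = v \<and> Inf K = u"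
    if xK: "(x, K) \<in> p" for x K
  proof -
    obtain u v where "K = cbox u v" using pD(4) xK by blast
    with pD(2)[OF xK] pD(3)[OF xK] show ?thesis by (intro exI[of _ u] exI[of _ v]) auto
  qed
  define q where "q = {(x, K) \<in> p. x \<in> N'}"
  have "finite q" "q \<subseteq> p" using \<open>finite p\<close> by (auto simp: q_def intro: finite_subset[OF _ \<open>finite p\<close>])
  have qpart: "q tagged_partial_division_of {a..b}"
    using p(1) \<open>q \<subseteq> p\<close> by (meson tagged_division_of_def tagged_partial_division_subset)
  have qdiv: "snd ` q division_of \<Union>(snd ` q)"
    by (rule partial_division_of_tagged_division[OF qpart])
  have qU: "\<Union>(snd ` q) \<subseteq> U" using p(2) unfolding q_def fine_def G_def by fastforce
  have qab: "\<Union>(snd ` q) \<subseteq> {a..b}" using pD(3) \<open>q \<subseteq> p\<close> by force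
  have "(\<Sum>K\<in>snd ` q. Sup K - Inf K) = (\<Sum>K\<in>snd ` q. measure lborel K)"
    using K \<open>q \<subseteq> p\<close> by (intro sum.cong) force+
  also have "\<dots> = measure lebesgue (\<Union>(snd ` q))"
    unfolding content_division[OF qdiv, symmetric]
  proof (rule sum.cong)
    fix K assume "K \<in> snd ` q"
    then obtain u v where "K = cbox u v" using division_ofD(4)[OF qdiv] by metis
    then show "measure lborel K = measure lebesgue K" by simp
  qed simp
  also have "\<dots> \<le> measure lebesgue U"
    using qU U(3) qdiv by (intro measure_mono_fmeasurable) (auto dest: division_of_finite intro: fmeasurableD lmeasurable_division)
  also have "\<dots> < d" by fact
  finally have "(\<Sum>K\<in>snd ` q. norm (F (Sup K) - F (Inf K))) < e"
    by (rule d[OF qdiv qab])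
  moreover have "(\<Sum>(x,K)\<in>q. norm (F (Sup K) - F (Inf K))) = (\<Sum>K\<in>snd ` q. norm (F (Sup K) - F (Inf K)))"
  proof -
    have ne: "K \<noteq> {}" if "(x, K) \<in> q" for x K
      using K that \<open>q \<subseteq> p\<close> by fastforce
    \<comment> \<open>Passing from tagged pairs to intervals requires a function that vanishes on
      every box with empty interior. \<open>Sup {}\<close> and \<open>Inf {}\<close> are
      unspecified, hence the separate case; on a singleton the difference is 0 anyway.\<close>
    let ?d = "\<lambda>K. if K = {} then 0 else norm (F (Sup K) - F (Inf K))"
    have "(\<Sum>(x,K)\<in>q. ?d K) = (\<Sum>K\<in>snd ` q. ?d K)"
      by (rule sum.over_tagged_division_lemma[OF tagged_partial_division_of_Union_self[OF qpart]])
        (auto simp: box_eq_empty)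
    moreover have "(\<Sum>(x,K)\<in>q. ?d K) = (\<Sum>(x,K)\<in>q. norm (F (Sup K) - F (Inf K)))"
      using ne by (intro sum.cong) auto
    moreover have "(\<Sum>K\<in>snd ` q. ?d K) = (\<Sum>K\<in>snd ` q. norm (F (Sup K) - F (Inf K)))"
      using ne by (intro sum.cong) auto
    ultimately show ?thesis by simp
  qed
  moreover have "(\<Sum>(x,K)\<in>q. F (Sup K) - F (Inf K)) \<le> (\<Sum>(x,K)\<in>q. norm (F (Sup K) - F (Inf K)))"
    by (intro sum_mono) auto
  ultimately have 1: "(\<Sum>(x,K)\<in>q. F (Sup K) - F (Inf K)) < e" by linarith
  have "F (Sup K) - F (Inf K) \<le> measure lborel K *\<^sub>R \<psi> x + e * measure lborel K" if xK: "(x, K) \<in> p - q" for x K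
  proof -
    obtain u v where uv: "K = {u..v}" "u \<le> x" "x \<le> v" "a \<le> u" "v \<le> b" "measure lborel K = v - u" "Sup K = v" "Inf K = u"
      using K xK by blast
    have x: "x \<in> {a..b} - N'" using xK uv by (auto simp: q_def)
    have "K \<subseteq> ball x (\<delta> x)" using p(2) xK x unfolding fine_def G_def by force
    then have "x - \<delta> x < u" "v < x + \<delta> x" using uv by (auto simp: subset_eq dist_real_def)
        (smt (verit) atLeastAtMost_iff)+
    then have "F v - F u \<le> (F' x + e) * (v - u)" using \<delta>(2)[OF x] uv by auto
    also have "\<dots> \<le> (\<phi> x + e) * (v - u)"
      using le[of x] x uv by (intro mult_right_mono) (auto simp: N'_def)
    finally show ?thesis using uv x by (auto simp: \<psi>_def algebra_simps)
  qed
  then have "(\<Sum>(x,K)\<in>p-q. F (Sup K) - F (Inf K)) \<le> (\<Sum>(x,K)\<in>p-q. measure lborel K *\<^sub>R \<psi> x + e * measure lborel K)"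
    by (intro sum_mono) auto
  also have "\<dots> \<le> (\<Sum>(x,K)\<in>p. measure lborel K *\<^sub>R \<psi> x + e * measure lborel K)"
    using \<open>finite p\<close> \<open>q \<subseteq> p\<close> \<open>e > 0\<close> by (intro sum_mono2) (auto simp: q_def \<psi>_def)
  also have "\<dots> = (\<Sum>(x,K)\<in>p. measure lborel K *\<^sub>R \<psi> x) + e * (\<Sum>(x,K)\<in>p. measure lborel K)"
    by (simp add: sum.distrib sum_distrib_left split_def)
  also have "(\<Sum>(x,K)\<in>p. measure lborel K) = b - a"
    using additive_content_tagged_division[of p a b] p(1) ab by simp
  finally have 2: "(\<Sum>(x,K)\<in>p-q. F (Sup K) - F (Inf K)) \<le> integral {a..b} \<phi> + e + e * (b - a)"
    using \<gamma>(2)[OF p(1) \<open>\<gamma> fine p\<close>] by (auto simp: abs_less_iff)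
  have "F b - F a = (\<Sum>(x,K)\<in>p. F (Sup K) - F (Inf K))"
    using additive_tagged_division_1[OF ab p(1), of F] by simp
  also have "\<dots> = (\<Sum>(x,K)\<in>p-q. F (Sup K) - F (Inf K)) + (\<Sum>(x,K)\<in>q. F (Sup K) - F (Inf K))"
    using \<open>finite p\<close> \<open>q \<subseteq> p\<close> by (rule sum.subset_diff[rotated])
  also have "\<dots> \<le> integral {a..b} \<phi> + e * (b - a + 2)" using 1 2 by (simp add: algebra_simps)
  also have "e * (b - a + 2) = \<epsilon>" using ab by (simp add: e_def)
  finally show "F b - F a \<le> integral {a..b} \<phi> + \<epsilon>" .
qed

section \<open>Gradients, Lipschitz maps and indefinite integrals\<close>

text \<open>\<open>gradient\<close> collects derivatives along the axes. Under differentiability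
  these are the values of the Frechet derivative on the axis vectors, and linearity recovers it in
  every direction.\<close>

lemma has_derivative_gradient:
  fixes V :: "real ^ 'k \<Rightarrow> real"
  assumes "V differentiable (at x)"
  shows "(V has_derivative (\<lambda>v. gradient V x \<bullet> v)) (at x)"
proof -
  obtain V' where V': "(V has_derivative V') (at x)"
    using assms unfolding differentiable_def by blast
  have lin: "linear V'" using V' has_derivative_linear by blast
  have "gradient V x $ i = V' (axis i 1)" for i
  proof -
    have "((\<lambda>s. V (x + s *\<^sub>R axis i 1)) has_derivative (\<lambda>s. V' (s *\<^sub>R axis i 1))) (at 0)"
      by (rule has_derivative_compose[of "\<lambda>s. x + s *\<^sub>R axis i 1" "\<lambda>s. s *\<^sub>R axis i 1" 0 UNIV V V'])
        (auto intro!: derivative_eq_intros V')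
    then have "((\<lambda>s. V (x + s *\<^sub>R axis i 1)) has_real_derivative V' (axis i 1)) (at 0)"
      using lin by (simp add: has_field_derivative_def linear_cmul mult_commute_abs)
    then show ?thesis unfolding gradient_def by (simp add: DERIV_imp_deriv)
  qed
  then have "V' v = gradient V x \<bullet> v" for v
  proof -
    have "V' v = V' (\<Sum>i\<in>UNIV. (v $ i) *\<^sub>R axis i 1)"
      using basis_expansion[of v] by (simp add: scalar_mult_eq_scaleR)
    also have "\<dots> = (\<Sum>i\<in>UNIV. v $ i * V' (axis i 1))"
      using lin by (simp add: linear_sum linear_cmul)
    finally show ?thesis
      using \<open>\<And>i. gradient V x $ i = V' (axis i 1)\<close> by (simp add: inner_vec_def mult.commute)
  qed
  then have "V' = (\<lambda>v. gradient V x \<bullet> v)" by (rule ext)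
  then show ?thesis using V' by simp
qed

text \<open>Reduction to \<open>local_lipschitz\<close>, whose time parameter is a dummy confined to
  \<open>{0}\<close>.\<close>

lemma locally_lipschitz_on_compact:
  fixes f :: "'a::metric_space \<Rightarrow> 'b::metric_space"
  assumes "locally_lipschitz_on X f" "compact K" "K \<subseteq> X"
  obtains L where "lipschitz_on L K f"
proof -
  have "local_lipschitz {0::real} K (\<lambda>_. f)"
  proof (rule local_lipschitzI)
    fix t x :: "real" and y assume "y \<in> K"
    then obtain e L where "e > 0" "lipschitz_on L (cball y e \<inter> X) f"
      using assms unfolding locally_lipschitz_on_def by blast
    then show "\<exists>u>0. \<exists>L. \<forall>t\<in>cball t u \<inter> {0}. L-lipschitz_on (cball y u \<inter> K) f"
      using assms(3) by (meson Int_mono lipschitz_on_subset order_refl)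
  qed
  then show thesis
    using local_lipschitz_compact_implies_lipschitz[of "{0::real}" K "\<lambda>_. f"] assms(2) that by auto
qed

text \<open>On a closed ball inside \<open>D\<close> the continuous gradient is bounded, and
  convexity of the ball gives the mean value inequality.\<close>

lemma C1_on_imp_locally_lipschitz_on:
  assumes "open D" "C1_on D V"
  shows "locally_lipschitz_on D V"
  unfolding locally_lipschitz_on_def
proof
  fix x assume "x \<in> D"
  then obtain e where e: "e > 0" "cball x e \<subseteq> D" using assms(1) open_contains_cball by blast
  have "compact (gradient V ` cball x e)"
    using assms(2) e unfolding C1_on_def by (intro compact_continuous_image) (auto intro: continuous_on_subset)
  then obtain B where B: "\<And>y. y \<in> cball x e \<Longrightarrow> norm (gradient V y) \<le> B"
    using compact_imp_bounded bounded_iff by (metis imageI)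
  have "0 \<le> B" using B[of x] e by (meson centre_in_cball less_imp_le norm_ge_zero order_trans)
  have "lipschitz_on B (cball x e) V"
  proof (rule lipschitz_onI)
    fix y z assume "y \<in> cball x e" "z \<in> cball x e"
    have "(V has_derivative (\<lambda>v. gradient V w \<bullet> v)) (at w within cball x e)" if "w \<in> cball x e" for w
      using that assms(2) e has_derivative_gradient has_derivative_at_withinI unfolding C1_on_def by blast
    moreover have "onorm (\<lambda>v. gradient V w \<bullet> v) \<le> B" if "w \<in> cball x e" for w
    proof (rule onorm_bound[OF \<open>0 \<le> B\<close>])
      fix v
      have "norm (gradient V w \<bullet> v) \<le> norm (gradient V w) * norm v"
        using Cauchy_Schwarz_ineq2 by simp
      also have "\<dots> \<le> B * norm v" using B[OF that] by (intro mult_right_mono) auto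
      finally show "norm (gradient V w \<bullet> v) \<le> B * norm v" .
    qed
    ultimately have "norm (V y - V z) \<le> B * norm (y - z)"
      using \<open>y \<in> cball x e\<close> \<open>z \<in> cball x e\<close> by (intro differentiable_bound[OF convex_cball]) blast+
    then show "dist (V y) (V z) \<le> B * dist y z" by (simp add: dist_norm)
  qed fact
  then show "\<exists>e>0. \<exists>L. L-lipschitz_on (cball x e \<inter> D) V"
    using e by (metis inf.absorb1)
qed

text \<open>Lebesgue differentiation on the line. \<open>integrable_ccontinuous_explicit\<close>
  controls the averages over \<open>{t..t+h}\<close> with \<open>h > 0\<close>; the averages to the
  left of \<open>t\<close> are those of the reflected function, so the exceptional set is
  \<open>N1\<close> together with the reflection of \<open>N2\<close>.\<close>

lemma integral_has_vector_derivative_ae: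
  fixes f :: "real \<Rightarrow> 'b::euclidean_space"
  assumes int: "f integrable_on {a..b}"
  obtains N where "negligible N"
    "\<And>t. t \<in> {a<..<b} - N \<Longrightarrow> ((\<lambda>t. integral {a..t} f) has_vector_derivative f t) (at t)"
proof -
  \<comment> \<open>Extension by zero makes the function integrable over every compact interval, as
    the averages require.\<close>
  define f\<^sub>0 where "f\<^sub>0 t = (if t \<in> {a..b} then f t else 0)" for t
  have "f\<^sub>0 integrable_on UNIV"
    using int unfolding f\<^sub>0_def by (simp only: integrable_restrict_UNIV)
  then have f0: "f\<^sub>0 integrable_on cbox c d" for c d
    by (rule integrable_on_subcbox) auto
  have f1: "(\<lambda>t. f\<^sub>0 (- t)) integrable_on cbox c d" for c d
    using f0[of "-d" "-c"] Henstock_Kurzweil_Integration.integrable_reflect_real[where f=f\<^sub>0 and a="-d" and b="-c"] by simp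
  obtain N1 where N1: "negligible N1" "\<And>t e. t \<notin> N1 \<Longrightarrow> 0 < e \<Longrightarrow>
      \<exists>d>0. \<forall>h. 0 < h \<and> h < d \<longrightarrow>
        norm (integral (cbox t (t + h *\<^sub>R One)) f\<^sub>0 /\<^sub>R h ^ DIM(real) - f\<^sub>0 t) < e"
    by (rule integrable_ccontinuous_explicit[OF f0]) blast
  note N1 = N1[simplified]
  obtain N2 where N2: "negligible N2" "\<And>t e. t \<notin> N2 \<Longrightarrow> 0 < e \<Longrightarrow>
      \<exists>d>0. \<forall>h. 0 < h \<and> h < d \<longrightarrow>
        norm (integral (cbox t (t + h *\<^sub>R One)) (\<lambda>t. f\<^sub>0 (- t)) /\<^sub>R h ^ DIM(real) - f\<^sub>0 (- t)) < e"
    by (rule integrable_ccontinuous_explicit[OF f1]) blast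
  note N2 = N2[simplified]
  define N where "N = N1 \<union> uminus ` N2"
  have "negligible (uminus ` N2)"
    by (rule negligible_differentiable_image_negligible[OF _ N2(1)]) (auto intro: differentiable_on_minus)
  then have "negligible N" using N1(1) by (simp add: N_def)
  moreover have "((\<lambda>t. integral {a..t} f) has_vector_derivative f t) (at t)"
    if t: "t \<in> {a<..<b} - N" for t
    unfolding has_vector_derivative_def has_derivative_at_alt
  proof (intro conjI allI impI bounded_linear_scaleR_left)
    fix e :: real assume "e > 0"
    obtain d1 where d1: "d1 > 0" "\<And>h. 0 < h \<Longrightarrow> h < d1 \<Longrightarrow> norm (integral {t..t+h} f\<^sub>0 /\<^sub>R h - f\<^sub>0 t) < e"
      using N1(2)[of t e] t \<open>e > 0\<close> by (auto simp: N_def)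
    have "- t \<notin> N2" using t by (force simp: N_def)
    then obtain d2 where d2: "d2 > 0" "\<And>h. 0 < h \<Longrightarrow> h < d2 \<Longrightarrow>
        norm (integral {-t..-t+h} (\<lambda>t. f\<^sub>0 (- t)) /\<^sub>R h - f\<^sub>0 t) < e"
      using N2(2)[of "-t" e] \<open>e > 0\<close> by auto
    \<comment> \<open>Besides respecting the two one-sided radii, \<open>d\<close> keeps
      \<open>y\<close> inside \<open>{a..b}\<close>, where \<open>f\<^sub>0\<close> and
      \<open>f\<close> agree.\<close>
    define d where "d = min (min d1 d2) (min (t - a) (b - t))"
    have "d > 0" using d1 d2 t by (auto simp: d_def)
    have f0eq: "integral {u..v} f\<^sub>0 = integral {u..v} f" if "a \<le> u" "v \<le> b" for u v
      using that by (intro integral_cong) (auto simp: f\<^sub>0_def)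
    have comb: "integral {a..u} f + integral {u..v} f = integral {a..v} f" if "a \<le> u" "u \<le> v" "v \<le> b" for u v
      using that by (intro Henstock_Kurzweil_Integration.integral_combine integrable_on_subinterval[OF int]) auto
    have scale: "norm (I - h *\<^sub>R c) \<le> e * h" if "norm (I /\<^sub>R h - c) < e" "h > 0" for I c :: 'b and h
    proof -
      have "I - h *\<^sub>R c = h *\<^sub>R (I /\<^sub>R h - c)" using that(2) by (simp add: scaleR_diff_right)
      then have "norm (I - h *\<^sub>R c) = h * norm (I /\<^sub>R h - c)" using that(2) by simp
      then show ?thesis using that by (simp add: mult.commute)
    qed
    have ft: "f\<^sub>0 t = f t" using t by (simp add: f\<^sub>0_def)
    show "\<exists>d>0. \<forall>y. norm (y - t) < d \<longrightarrow>
        norm (integral {a..y} f - integral {a..t} f - (y - t) *\<^sub>R f t) \<le> e * norm (y - t)"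
    proof (intro exI[of _ d] conjI allI impI)
      fix y assume y: "norm (y - t) < d"
      consider "y = t" | "y > t" | "y < t" by linarith
      then show "norm (integral {a..y} f - integral {a..t} f - (y - t) *\<^sub>R f t) \<le> e * norm (y - t)"
      proof cases
        case 2
        then have "norm (integral {t..y} f\<^sub>0 - (y - t) *\<^sub>R f t) \<le> e * (y - t)"
          using d1(2)[of "y - t"] y scale[where I="integral {t..y} f\<^sub>0" and h="y - t" and c="f t"] by (auto simp: d_def ft)
        moreover have "integral {t..y} f\<^sub>0 = integral {a..y} f - integral {a..t} f"
          using 2 y t f0eq[of t y] comb[of t y, symmetric] by (auto simp: d_def)
        ultimately show ?thesis using 2 by simp
      next
        case 3
        have "integral {-t..-y} (\<lambda>t. f\<^sub>0 (- t)) = integral {y..t} f\<^sub>0"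
          by (rule Henstock_Kurzweil_Integration.integral_reflect_real)
        then have "norm (integral {y..t} f\<^sub>0 - (t - y) *\<^sub>R f t) \<le> e * (t - y)"
          using 3 d2(2)[of "t - y"] y scale[where I="integral {y..t} f\<^sub>0" and h="t - y" and c="f t"] by (auto simp: d_def ft)
        moreover have "integral {a..y} f - integral {a..t} f - (y - t) *\<^sub>R f t = - (integral {y..t} f\<^sub>0 - (t - y) *\<^sub>R f t)"
          using 3 y t f0eq[of y t] comb[of y t, symmetric] by (auto simp: d_def algebra_simps)
        ultimately show ?thesis using 3 by (simp only: norm_minus_cancel) simp
      qed simp
    qed fact
  qed
  ultimately show thesis using that by blast
qed

text \<open>McShane's formula.\<close>

lemma lipschitz_on_extend_real:
  fixes f :: "'a::metric_space \<Rightarrow> real"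
  assumes lip: "lipschitz_on L C f"
  obtains g where "lipschitz_on L UNIV g" "\<And>x. x \<in> C \<Longrightarrow> g x = f x"
proof (cases "C = {}")
  case True
  show thesis by (rule that[of "\<lambda>_. 0"]) (use True lip lipschitz_on_nonneg in \<open>auto intro!: lipschitz_onI\<close>)
next
  case False
  have L: "0 \<le> L" using lip lipschitz_on_nonneg by blast
  define g where "g x = (INF y\<in>C. f y + L * dist x y)" for x
  \<comment> \<open>With \<open>z\<close> fixed this makes the infimum finite; with
    \<open>x = z\<close> it says that the extension does not drop below \<open>f\<close> on
    \<open>C\<close>.\<close>
  have low: "f z - L * dist x z \<le> f y + L * dist x y" if "y \<in> C" "z \<in> C" for x y z
  proof -
    have "f z - f y \<le> L * dist z y" using lipschitz_onD[OF lip that(2,1)] by (auto simp: dist_real_def)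
    also have "\<dots> \<le> L * (dist x z + dist x y)"
      using L by (intro mult_left_mono) (metis dist_commute dist_triangle2 dist_triangle3)+
    finally show ?thesis by (simp add: algebra_simps)
  qed
  have bdd: "bdd_below ((\<lambda>y. f y + L * dist x y) ` C)" for x
    using low False by (meson bdd_belowI2 ex_in_conv)
  have one: "g x \<le> g z + L * dist x z" for x z
  proof -
    have "g x - L * dist x z \<le> f y + L * dist z y" if "y \<in> C" for y
    proof -
      have "g x \<le> f y + L * dist x y" unfolding g_def by (rule cINF_lower[OF bdd that])
      also have "\<dots> \<le> f y + L * (dist x z + dist z y)"
        using L by (intro add_left_mono mult_left_mono dist_triangle) 
      finally show ?thesis by (simp add: algebra_simps)
    qed
    then have "g x - L * dist x z \<le> g z" unfolding g_def[of z] by (rule cINF_greatest[OF False])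
    then show ?thesis by simp
  qed
  have "lipschitz_on L UNIV g"
  proof (rule lipschitz_onI)
    show "dist (g x) (g z) \<le> L * dist x z" for x z
      using one[of x z] one[of z x] by (auto simp: dist_real_def dist_commute abs_le_iff)
  qed (rule L)
  moreover have "g x = f x" if "x \<in> C" for x
  proof (rule antisym)
    show "g x \<le> f x" using cINF_lower[OF bdd[of x] that] by (simp add: g_def)
    show "f x \<le> g x" unfolding g_def using low[OF _ that, of _ x] by (intro cINF_greatest[OF False]) auto
  qed
  ultimately show thesis using that by blast
qed

text \<open>The scalar extension is applied to each coordinate. The constant grows by the dimension,
  which is harmless: the Picard argument works with any global constant.\<close>

lemma lipschitz_on_extend:
  fixes f :: "'a::metric_space \<Rightarrow> 'b::euclidean_space"
  assumes lip: "lipschitz_on L C f"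
  obtains M g where "lipschitz_on M UNIV g" "\<And>x. x \<in> C \<Longrightarrow> g x = f x"
proof -
  have L: "0 \<le> L" using lip lipschitz_on_nonneg by blast
  have "\<exists>g. lipschitz_on L UNIV g \<and> (\<forall>x\<in>C. g x = f x \<bullet> b)" if b: "b \<in> Basis" for b :: 'b
  proof -
    have "lipschitz_on L C (\<lambda>x. f x \<bullet> b)"
    proof (rule lipschitz_onI)
      fix x y assume "x \<in> C" "y \<in> C"
      have "dist (f x \<bullet> b) (f y \<bullet> b) \<le> dist (f x) (f y)"
        using Basis_le_norm[OF b, of "f x - f y"] by (simp add: dist_norm inner_diff_left)
      also have "\<dots> \<le> L * dist x y" using lipschitz_onD[OF lip] \<open>x \<in> C\<close> \<open>y \<in> C\<close> by blast
      finally show "dist (f x \<bullet> b) (f y \<bullet> b) \<le> L * dist x y" .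
    qed fact
    from lipschitz_on_extend_real[OF this] show ?thesis by metis
  qed
  then obtain g where g: "\<And>b. b \<in> Basis \<Longrightarrow> lipschitz_on L UNIV (g b)"
    "\<And>b x. b \<in> (Basis::'b set) \<Longrightarrow> x \<in> C \<Longrightarrow> g b x = f x \<bullet> b"
    by metis
  have "lipschitz_on (real DIM('b) * L) UNIV (\<lambda>x. \<Sum>b\<in>Basis. g b x *\<^sub>R b)"
  proof (rule lipschitz_onI)
    fix x y
    have "dist (\<Sum>b\<in>Basis. g b x *\<^sub>R b) (\<Sum>b\<in>Basis. g b y *\<^sub>R b) = norm (\<Sum>b\<in>Basis. (g b x - g b y) *\<^sub>R b)"
      by (simp add: dist_norm sum_subtractf scaleR_diff_left)
    also have "\<dots> \<le> (\<Sum>b\<in>(Basis::'b set). L * dist x y)"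
    proof (rule sum_norm_le)
      fix b :: 'b assume b: "b \<in> Basis"
      then show "norm ((g b x - g b y) *\<^sub>R b) \<le> L * dist x y"
        using lipschitz_onD[OF g(1)[OF b], of x y] by (simp add: dist_real_def)
    qed
    finally show "dist (\<Sum>b\<in>Basis. g b x *\<^sub>R b) (\<Sum>b\<in>Basis. g b y *\<^sub>R b) \<le> real DIM('b) * L * dist x y"
      by (simp add: mult.assoc)
  qed (use L in simp)
  moreover have "(\<Sum>b\<in>Basis. g b x *\<^sub>R b) = f x" if "x \<in> C" for x
    using g(2) that by (simp add: euclidean_representation)
  ultimately show thesis using that by blast
qed

section \<open>Integral equations with a Lipschitz right-hand side\<close>

text \<open>After division by \<open>a + b\<close> both summands lie in the unit interval, where
  \<open>x \<le> x powr q\<close>, and they add up to 1.\<close>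

lemma powr_add_le:
  fixes a b q :: real
  assumes "0 \<le> a" "0 \<le> b" "0 < q" "q \<le> 1"
  shows "(a + b) powr q \<le> a powr q + b powr q"
proof (cases "a + b = 0")
  case False
  then have s: "a + b > 0" using assms by linarith
  have *: "x / (a + b) \<le> (x / (a + b)) powr q" if "0 \<le> x" "x \<le> a + b" for x
    using powr_mono'[of q 1 "x / (a + b)"] that assms s by auto
  have "1 = a / (a + b) + b / (a + b)" using s by (simp add: add_divide_distrib[symmetric])
  also have "\<dots> \<le> (a / (a + b)) powr q + (b / (a + b)) powr q"
    using *[of a] *[of b] assms by linarith
  also have "\<dots> = (a powr q + b powr q) / (a + b) powr q"
    using assms s by (simp add: powr_divide add_divide_distrib)
  finally show ?thesis using s by (simp add: field_simps)
qed (use assms in auto)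

lemma has_integral_exp_mult:
  fixes c :: real
  assumes "c \<noteq> 0" "0 \<le> t"
  shows "((\<lambda>s. exp (c * s)) has_integral (exp (c * t) - 1) / c) {0..t}"
proof -
  have "((\<lambda>s. exp (c * s)) has_integral (exp (c * t) / c - exp (c * 0) / c)) {0..t}"
    using assms by (intro fundamental_theorem_of_calculus)
      (auto simp: has_real_derivative_iff_has_vector_derivative[symmetric] intro!: derivative_eq_intros)
  then show ?thesis by (simp add: diff_divide_distrib)
qed

text \<open>\<open>int\<close> asks for integrability along every continuous curve, in place of
  continuity in time. \<open>lip\<close> is Lipschitz continuity in the maximum norm over
  \<open>I\<close>, written with a common bound \<open>B\<close> because functions on
  \<open>nat\<close> carry no norm here; for \<open>B = 0\<close> it says that components outside
  \<open>I\<close> have no influence.\<close>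

locale lipschitz_family =
  fixes F :: "real \<Rightarrow> (nat \<Rightarrow> 'a::euclidean_space) \<Rightarrow> nat \<Rightarrow> 'a"
    and I :: "nat set" and T L :: real
  assumes fin: "finite I" and T: "0 \<le> T" and L: "0 < L"
    and int: "\<And>y i. i \<in> I \<Longrightarrow> (\<And>j. j \<in> I \<Longrightarrow> continuous_on {0..T} (\<lambda>t. y t j)) \<Longrightarrow>
      (\<lambda>s. F s (y s) i) integrable_on {0..T}"
    and lip: "\<And>s y z i B. s \<in> {0..T} \<Longrightarrow> i \<in> I \<Longrightarrow> (\<And>j. j \<in> I \<Longrightarrow> norm (y j - z j) \<le> B) \<Longrightarrow>
      norm (F s y i - F s z i) \<le> L * B"
begin

lemma int_sub:
  assumes "i \<in> I" "\<And>j. j \<in> I \<Longrightarrow> continuous_on {0..T} (\<lambda>t. y t j)" "t \<le> T"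
  shows "(\<lambda>s. F s (y s) i) integrable_on {0..t}"
  by (rule integrable_on_subinterval[OF int[OF assms(1,2)]]) (use assms(3) in auto)

text \<open>Weighting by \<open>exp (2 * L * t)\<close> makes the Picard operator a contraction with factor 1/2.\<close>

lemma contraction:
  assumes y: "\<And>j. j \<in> I \<Longrightarrow> continuous_on {0..T} (\<lambda>t. y t j)"
    and z: "\<And>j. j \<in> I \<Longrightarrow> continuous_on {0..T} (\<lambda>t. z t j)"
    and B: "\<And>s j. s \<in> {0..T} \<Longrightarrow> j \<in> I \<Longrightarrow> norm (y s j - z s j) \<le> exp (2 * L * s) * B" "0 \<le> B"
    and i: "i \<in> I" and t: "t \<in> {0..T}"
  shows "norm (integral {0..t} (\<lambda>s. F s (y s) i) - integral {0..t} (\<lambda>s. F s (z s) i))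
           \<le> exp (2 * L * t) * (B / 2)"
proof -
  have iy: "(\<lambda>s. F s (y s) i) integrable_on {0..t}" and iz: "(\<lambda>s. F s (z s) i) integrable_on {0..t}"
    using int_sub[OF i y] int_sub[OF i z] t by auto
  have E: "((\<lambda>s. L * B * exp (2 * L * s)) has_integral L * B * ((exp (2 * L * t) - 1) / (2 * L))) {0..t}"
    using L t by (intro has_integral_mult_right has_integral_exp_mult) auto
  have "norm (integral {0..t} (\<lambda>s. F s (y s) i) - integral {0..t} (\<lambda>s. F s (z s) i))
      = norm (integral {0..t} (\<lambda>s. F s (y s) i - F s (z s) i))"
    by (simp add: integral_diff[OF iy iz])
  also have "\<dots> \<le> integral {0..t} (\<lambda>s. L * B * exp (2 * L * s))"
  proof (rule integral_norm_bound_integral)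
    fix s assume "s \<in> {0..t}"
    then have "s \<in> {0..T}" using t by auto
    from lip[OF this i B(1)[OF this]] show "norm (F s (y s) i - F s (z s) i) \<le> L * B * exp (2 * L * s)"
      by (simp add: mult_ac)
  qed (use iy iz E in \<open>auto intro: integrable_diff\<close>)
  also have "\<dots> = B / 2 * (exp (2 * L * t) - 1)"
    unfolding integral_unique[OF E] using L by (simp add: field_simps)
  also have "\<dots> \<le> exp (2 * L * t) * (B / 2)" using B(2) by (simp add: algebra_simps)
  finally show ?thesis .
qed

text \<open>The starting bound for the iterations below. The weight is at least 1 for
  \<open>s \<ge> 0\<close>, so an unweighted bound suffices; summing over \<open>I\<close> instead
  of taking a maximum also covers an empty \<open>I\<close>.\<close>

lemma weighted_bound:
  assumes y: "\<And>j. j \<in> I \<Longrightarrow> continuous_on {0..T} (\<lambda>t. y t j)"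
    and z: "\<And>j. j \<in> I \<Longrightarrow> continuous_on {0..T} (\<lambda>t. z t j)"
  obtains B where "0 \<le> B"
    "\<And>s j. s \<in> {0..T} \<Longrightarrow> j \<in> I \<Longrightarrow> norm (y s j - z s j) \<le> exp (2 * L * s) * B"
proof -
  have "\<exists>B. \<forall>s\<in>{0..T}. norm (y s j - z s j) \<le> B" if "j \<in> I" for j
  proof -
    have "bounded ((\<lambda>s. y s j - z s j) ` {0..T})"
      using y[OF that] z[OF that]
      by (intro compact_imp_bounded compact_continuous_image continuous_on_diff) auto
    then show ?thesis by (auto simp: bounded_iff)
  qed
  then obtain B where B: "\<And>j s. j \<in> I \<Longrightarrow> s \<in> {0..T} \<Longrightarrow> norm (y s j - z s j) \<le> B j" by metis
  define B0 where "B0 = (\<Sum>j\<in>I. \<bar>B j\<bar>)"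
  have "0 \<le> B0" by (simp add: B0_def sum_nonneg)
  have "norm (y s j - z s j) \<le> exp (2 * L * s) * B0" if "s \<in> {0..T}" "j \<in> I" for j s
  proof -
    have "norm (y s j - z s j) \<le> \<bar>B j\<bar>" using B[OF that(2,1)] by linarith
    also have "\<dots> \<le> B0" unfolding B0_def using fin that by (intro member_le_sum) auto
    also have "\<dots> \<le> exp (2 * L * s) * B0"
      using mult_right_mono[of 1 "exp (2 * L * s)" B0] \<open>0 \<le> B0\<close> L that by simp
    finally show ?thesis .
  qed
  then show thesis using that \<open>0 \<le> B0\<close> by blast
qed

text \<open>Two fixed points of the Picard operator: each application of \<open>contraction\<close>
  halves the bound on their weighted distance, which is therefore 0.\<close>

lemma integral_solution_unique:
  assumes y: "\<And>j. j \<in> I \<Longrightarrow> continuous_on {0..T} (\<lambda>t. y t j)"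
      "\<And>j t. j \<in> I \<Longrightarrow> t \<in> {0..T} \<Longrightarrow> y t j = \<xi> j + integral {0..t} (\<lambda>s. F s (y s) j)"
    and z: "\<And>j. j \<in> I \<Longrightarrow> continuous_on {0..T} (\<lambda>t. z t j)"
      "\<And>j t. j \<in> I \<Longrightarrow> t \<in> {0..T} \<Longrightarrow> z t j = \<xi> j + integral {0..t} (\<lambda>s. F s (z s) j)"
    and "j \<in> I" "t \<in> {0..T}"
  shows "y t j = z t j"
proof -
  obtain B where "0 \<le> B"
    and B: "\<And>s j. s \<in> {0..T} \<Longrightarrow> j \<in> I \<Longrightarrow> norm (y s j - z s j) \<le> exp (2 * L * s) * B"
    using weighted_bound[of y z, OF y(1) z(1)] by blast
  have k: "norm (y s j - z s j) \<le> exp (2 * L * s) * (B / 2 ^ k)" if "s \<in> {0..T}" "j \<in> I" for j s k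
    using that
  proof (induction k arbitrary: j s)
    case (Suc k)
    have "norm (y s j - z s j) \<le> exp (2 * L * s) * (B / 2 ^ k / 2)"
      using contraction[OF y(1) z(1) Suc.IH _ Suc.prems(2,1)] \<open>0 \<le> B\<close>
        y(2)[OF Suc.prems(2,1)] z(2)[OF Suc.prems(2,1)] by simp
    then show ?case by (simp add: mult.commute)
  qed (use B in simp)
  have "(\<lambda>k. exp (2 * L * t) * (B / 2 ^ k)) \<longlonglongrightarrow> exp (2 * L * t) * 0"
    by (intro tendsto_mult_left LIMSEQ_divide_realpow_zero) auto
  then have "norm (y t j - z t j) \<le> exp (2 * L * t) * 0"
    using k[OF \<open>t \<in> {0..T}\<close> \<open>j \<in> I\<close>] by (intro LIMSEQ_le_const) auto
  then show ?thesis by simp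
qed

text \<open>Picard iteration from the constant curve. Consecutive iterates differ by a geometric
  sequence, so they converge uniformly; the limit passes through the integral by
  \<open>contraction\<close> itself, without a separate convergence theorem for integrals.\<close>

lemma integral_solution_exists:
  obtains x where "\<And>j. j \<in> I \<Longrightarrow> continuous_on {0..T} (\<lambda>t. x t j)"
      "\<And>j t. j \<in> I \<Longrightarrow> t \<in> {0..T} \<Longrightarrow> x t j = \<xi> j + integral {0..t} (\<lambda>s. F s (x s) j)"
proof -
  define P where "P y t i = \<xi> i + integral {0..t} (\<lambda>s. F s (y s) i)" for y t i
  define X where "X k = (P ^^ k) (\<lambda>_. \<xi>)" for k
  have X_Suc: "X (Suc k) = P (X k)" for k by (simp add: X_def)
  have X: "continuous_on {0..T} (\<lambda>t. X k t j)" if "j \<in> I" for k j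
    using that
  proof (induction k arbitrary: j)
    case (Suc k)
    show ?case unfolding X_Suc P_def
      by (intro continuous_intros indefinite_integral_continuous_1 int Suc)
  qed (simp add: X_def)
  obtain B where "0 \<le> B"
    and B: "\<And>s j. s \<in> {0..T} \<Longrightarrow> j \<in> I \<Longrightarrow> norm (X 1 s j - X 0 s j) \<le> exp (2 * L * s) * B"
    using weighted_bound[of "X 1" "X 0", OF X X] by blast
  have diff: "norm (X (Suc k) s j - X k s j) \<le> exp (2 * L * s) * (B / 2 ^ k)"
    if "s \<in> {0..T}" "j \<in> I" for j s k
    using that
  proof (induction k arbitrary: j s)
    case (Suc k)
    have "norm (P (X (Suc k)) s j - P (X k) s j) \<le> exp (2 * L * s) * (B / 2 ^ k / 2)"
      using contraction[OF X X Suc.IH _ Suc.prems(2,1)] \<open>0 \<le> B\<close> by (simp add: P_def)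
    then show ?case by (simp add: X_Suc[symmetric] mult.commute)
  qed (use B in simp)
  define x where "x t j = X 0 t j + (\<Sum>k. X (Suc k) t j - X k t j)" for t j
  have unif: "uniform_limit {0..T} (\<lambda>k t. X k t j) (\<lambda>t. x t j) sequentially" if j: "j \<in> I" for j
  proof -
    have "uniform_limit {0..T} (\<lambda>n t. \<Sum>k<n. X (Suc k) t j - X k t j)
        (\<lambda>t. \<Sum>k. X (Suc k) t j - X k t j) sequentially"
    proof (rule Weierstrass_m_test)
      fix k t assume t: "t \<in> {0..T}"
      have "exp (2 * L * t) * (B / 2 ^ k) \<le> exp (2 * L * T) * (B / 2 ^ k)"
        using t L \<open>0 \<le> B\<close> by (intro mult_right_mono) auto
      then show "norm (X (Suc k) t j - X k t j) \<le> exp (2 * L * T) * B * (1 / 2) ^ k"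
        using diff[OF t j, of k] by (simp add: power_one_over)
    qed (intro summable_mult, simp)
    then have "uniform_limit {0..T} (\<lambda>n t. X 0 t j + (\<Sum>k<n. X (Suc k) t j - X k t j)) (\<lambda>t. x t j) sequentially"
      unfolding x_def by (intro uniform_limit_add uniform_limit_const)
    moreover have "X 0 t j + (\<Sum>k<n. X (Suc k) t j - X k t j) = X n t j" for n t
      using sum_lessThan_telescope[of "\<lambda>k. X k t j" n] by simp
    ultimately show ?thesis by simp
  qed
  have x: "continuous_on {0..T} (\<lambda>t. x t j)" if "j \<in> I" for j
    by (rule uniform_limit_theorem[OF _ unif[OF that]]) (use X[OF that] in auto)
  have "x t j = P x t j" if j: "j \<in> I" and t: "t \<in> {0..T}" for t j
  proof (rule LIMSEQ_unique)
    show "(\<lambda>k. X (Suc k) t j) \<longlonglongrightarrow> x t j"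
      by (rule LIMSEQ_Suc[OF tendsto_uniform_limitI[OF unif[OF j] t]])
    show "(\<lambda>k. X (Suc k) t j) \<longlonglongrightarrow> P x t j"
    proof (rule metric_LIMSEQ_I)
      fix r :: real assume "r > 0"
      \<comment> \<open>Chosen so that the contraction estimate ends with
        \<open>exp (2 * L * T) * (e / 2) = r / 2\<close>.\<close>
      define e where "e = r / exp (2 * L * T)"
      have "e > 0" using \<open>r > 0\<close> by (simp add: e_def)
      \<comment> \<open>Finiteness of \<open>I\<close> yields one index from which all components
        are uniformly close.\<close>
      have "\<forall>\<^sub>F k in sequentially. \<forall>i\<in>I. \<forall>s\<in>{0..T}. dist (X k s i) (x s i) < e"
        using unif \<open>e > 0\<close> fin by (auto simp: eventually_ball_finite_distrib uniform_limit_iff)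
      then obtain n where n: "\<And>k i s. k \<ge> n \<Longrightarrow> i \<in> I \<Longrightarrow> s \<in> {0..T} \<Longrightarrow> dist (X k s i) (x s i) < e"
        unfolding eventually_sequentially by blast
      have "dist (X (Suc k) t j) (P x t j) < r" if "k \<ge> n" for k
      proof -
        have "norm (X k s i - x s i) \<le> exp (2 * L * s) * e" if "s \<in> {0..T}" "i \<in> I" for s i
        proof -
          have "norm (X k s i - x s i) \<le> 1 * e" using n[OF \<open>k \<ge> n\<close> that(2,1)] by (simp add: dist_norm)
          also have "\<dots> \<le> exp (2 * L * s) * e"
            using \<open>e > 0\<close> L that by (intro mult_right_mono) auto
          finally show ?thesis .
        qed
        from contraction[OF X x this _ j t]
        have "dist (X (Suc k) t j) (P x t j) \<le> exp (2 * L * t) * (e / 2)"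
          using \<open>e > 0\<close> by (simp add: X_Suc P_def dist_norm)
        also have "\<dots> \<le> exp (2 * L * T) * (e / 2)"
          using \<open>e > 0\<close> L t by (intro mult_right_mono) auto
        also have "\<dots> < r" using \<open>r > 0\<close> by (simp add: e_def)
        finally show ?thesis .
      qed
      then show "\<exists>n. \<forall>k\<ge>n. dist (X (Suc k) t j) (P x t j) < r" by blast
    qed
  qed
  then show thesis using that[of x] x by (simp add: P_def)
qed

end

section \<open>Solutions of the string\<close>

definition neighbours ::
    "nat \<Rightarrow> (real \<Rightarrow> 'a) \<Rightarrow> (real \<Rightarrow> 'a) \<Rightarrow> (real \<Rightarrow> nat \<Rightarrow> 'a) \<Rightarrow> real \<Rightarrow> nat \<Rightarrow> 'a \<times> 'a \<times> 'a" where
  "neighbours n u w x t i =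
     (with_boundary n u w x t (i - 1), with_boundary n u w x t i, with_boundary n u w x t (i + 1))"

lemma with_boundary_simps [simp]:
  "with_boundary n u w x t 0 = u t" "with_boundary n u w x t (Suc n) = w t"
  "i \<in> {1..n} \<Longrightarrow> with_boundary n u w x t i = x t i"
  by (auto simp: with_boundary_def)

lemma with_boundary_mem:
  "u t \<in> A \<Longrightarrow> w t \<in> A \<Longrightarrow> (\<And>i. i \<in> {1..n} \<Longrightarrow> x t i \<in> A) \<Longrightarrow> j \<le> n + 1 \<Longrightarrow>
    with_boundary n u w x t j \<in> A"
  by (auto simp: with_boundary_def)

lemma neighbours_mem:
  assumes "u t \<in> A" "w t \<in> A" "\<And>i. i \<in> {1..n} \<Longrightarrow> x t i \<in> A" "i \<in> {1..n}"
  shows "neighbours n u w x t i \<in> A \<times> A \<times> A"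
  using assms with_boundary_mem[of u t A w n x] unfolding neighbours_def by auto

text \<open>Only the values at time \<open>t\<close> and the components in \<open>{1..n}\<close>
  enter. This justifies replacing inputs by truncations off a negligible set, and a curve by the
  constant curve through its current state.\<close>

lemma neighbours_cong:
  assumes "u t = u' t" "w t = w' t" "\<And>i. i \<in> {1..n} \<Longrightarrow> x t i = x' t i" "i \<in> {1..n}"
  shows "neighbours n u w x t i = neighbours n u' w' x' t i"
proof -
  have *: "with_boundary n u w x t j = with_boundary n u' w' x' t j" if "j \<le> n + 1" for j
    using that assms(1-3) by (auto simp: with_boundary_def)
  have "i - 1 \<le> n + 1" "i \<le> n + 1" "i + 1 \<le> n + 1" using assms(4) by auto
  then show ?thesis unfolding neighbours_def by (simp only: *)
qed

section \<open>Input signals, their truncation, and solutions in integral form\<close>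

lemma integrable_bounded_measurable_Icc:
  fixes f :: "real \<Rightarrow> 'b::euclidean_space"
  assumes "f \<in> borel_measurable (lebesgue_on {a..b})"
    and "AE t in lebesgue_on {a..b}. norm (f t) \<le> B"
  shows "integrable (lebesgue_on {a..b}) f"
proof -
  interpret finite_measure "lebesgue_on {a..b}" by (rule finite_measure_lebesgue_on) simp
  show ?thesis by (rule integrable_const_bound[OF assms(2,1)])
qed

lemma signal_measurable:
  assumes "u \<in> signals A"
  shows "u \<in> borel_measurable (lebesgue_on {0..T})"
  using assms unfolding signals_def
  by (auto intro: measurable_restrict_mono[of u _ "{0..}"])

lemma signal_compact:
  assumes "u \<in> signals A"
  obtains K where "compact K" "K \<subseteq> A" "AE t in lebesgue_on {0..T}. u t \<in> K"
proof -
  \<comment> \<open>\<open>signals\<close> speaks of positive horizons only; this one is positive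
    for every real \<open>T\<close> and exceeds it.\<close>
  have "0 < \<bar>T\<bar> + 1" by simp
  then obtain K where K: "compact K" "K \<subseteq> A" "AE t in lebesgue_on {0..\<bar>T\<bar>+1}. u t \<in> K"
    using assms unfolding signals_def by blast
  have "AE t in lebesgue_on {0..T}. u t \<in> K"
    using K(3) by (auto simp: AE_restrict_space_iff elim!: eventually_mono)
  then show thesis using that K by blast
qed

text \<open>A signal lies in its compact set only almost everywhere, while the compactness arguments
  want all values there. Exceptional values are replaced by 0, which is why 0 must belong to
  \<open>A\<close> and is added to the compact set; integrals do not notice the change.\<close>

lemma signal_truncate:
  fixes u :: "real \<Rightarrow> 'a::euclidean_space"
  assumes u: "u \<in> signals A" and "0 \<in> A"
  obtains K u' N where "compact K" "K \<subseteq> A" "\<And>t. u' t \<in> K"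
    "u' \<in> borel_measurable (lebesgue_on {0..T})" "negligible N" "\<And>t. t \<in> {0..T} - N \<Longrightarrow> u' t = u t"
proof -
  obtain K where K: "compact K" "K \<subseteq> A" "AE t in lebesgue_on {0..T}. u t \<in> K"
    using signal_compact[OF u] by blast
  obtain N where N: "negligible N" "\<And>t. t \<in> {0..T} - N \<Longrightarrow> u t \<in> K"
    using K(3) by (subst (asm) AE_lebesgue_on_iff_negligible) auto
  define u' where "u' t = (if u t \<in> K then u t else 0)" for t
  have "K \<in> sets borel" using K(1) by (simp add: compact_imp_closed borel_closed)
  then have "u' \<in> borel_measurable (lebesgue_on {0..T})"
    unfolding u'_def using signal_measurable[OF u, of T] measurable_sets[OF signal_measurable[OF u, of T]]
    by (intro measurable_If) (simp_all add: vimage_def Int_def conj_commute)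
  then show thesis
    by (rule that[of "insert 0 K" u' N, rotated 3]) (use K N assms(2) in \<open>auto simp: u'_def\<close>)
qed

text \<open>The Caratheodory solution on a bounded horizon as an integral equation. The initial
  condition is the case \<open>t = 0\<close>, where the integral vanishes. Components outside
  \<open>{1..n}\<close> are left free, and a negative \<open>T\<close> makes the condition
  vacuous.\<close>

definition integral_solution ::
    "(real ^ 'k) set \<Rightarrow> ((real ^ 'k) \<times> (real ^ 'k) \<times> (real ^ 'k) \<Rightarrow> real ^ 'k) \<Rightarrow> nat \<Rightarrow> real \<Rightarrow>
     (real \<Rightarrow> real ^ 'k) \<Rightarrow> (real \<Rightarrow> real ^ 'k) \<Rightarrow> (nat \<Rightarrow> real ^ 'k) \<Rightarrow>
     (real \<Rightarrow> nat \<Rightarrow> real ^ 'k) \<Rightarrow> bool" where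
  "integral_solution D f n T u w \<xi> x \<longleftrightarrow>
     (\<forall>i\<in>{1..n}. continuous_on {0..T} (\<lambda>t. x t i) \<and> (\<forall>t\<in>{0..T}. x t i \<in> D \<and>
        ((\<lambda>s. f (neighbours n u w x s i)) has_integral x t i - \<xi> i) {0..t}))"

lemma integral_solutionD:
  assumes "integral_solution D f n T u w \<xi> x" "i \<in> {1..n}"
  shows "continuous_on {0..T} (\<lambda>t. x t i)"
    and "t \<in> {0..T} \<Longrightarrow> x t i \<in> D"
    and "t \<in> {0..T} \<Longrightarrow> ((\<lambda>s. f (neighbours n u w x s i)) has_integral x t i - \<xi> i) {0..t}"
  using assms unfolding integral_solution_def by auto

lemma integral_solution_mono:
  "integral_solution D f n T u w \<xi> x \<Longrightarrow> T' \<le> T \<Longrightarrow> integral_solution D f n T' u w \<xi> x"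
  unfolding integral_solution_def by (auto intro: continuous_on_subset)

lemma integral_solution_cong:
  assumes sol: "integral_solution D f n T u w \<xi> x"
    and eq: "\<And>t i. t \<in> {0..T} \<Longrightarrow> i \<in> {1..n} \<Longrightarrow> x t i = y t i"
  shows "integral_solution D f n T u w \<xi> y"
  unfolding integral_solution_def
proof (intro ballI conjI)
  fix i assume i: "i \<in> {1..n}"
  show "continuous_on {0..T} (\<lambda>t. y t i)"
    using continuous_on_eq[OF integral_solutionD(1)[OF sol i]] eq i by auto
  fix t assume t: "t \<in> {0..T}"
  show "y t i \<in> D" using integral_solutionD(2)[OF sol i t] eq[OF t i] by simp
  have "f (neighbours n u w x s i) = f (neighbours n u w y s i)" if "s \<in> {0..t}" for s
    using that t eq i by (intro arg_cong[of _ _ f] neighbours_cong) auto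
  then show "((\<lambda>s. f (neighbours n u w y s i)) has_integral y t i - \<xi> i) {0..t}"
    using has_integral_eq[OF _ integral_solutionD(3)[OF sol i t]] eq[OF t i] by simp
qed

lemma integral_solution_initial:
  assumes "integral_solution D f n T u w \<xi> x" "i \<in> {1..n}" "0 \<le> T"
  shows "x 0 i = \<xi> i"
  using integral_unique[OF integral_solutionD(3)[OF assms(1,2), of 0]] assms(3) by simp

lemma integral_solution_compact_range:
  assumes sol: "integral_solution D f n T u w \<xi> x"
  obtains C where "compact C" "C \<subseteq> D" "\<And>t i. t \<in> {0..T} \<Longrightarrow> i \<in> {1..n} \<Longrightarrow> x t i \<in> C"
proof (rule that[of "\<Union>i\<in>{1..n}. (\<lambda>t. x t i) ` {0..T}"])
  show "compact (\<Union>i\<in>{1..n}. (\<lambda>t. x t i) ` {0..T})"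
    using integral_solutionD(1)[OF sol] by (intro compact_UN compact_continuous_image) auto
  show "(\<Union>i\<in>{1..n}. (\<lambda>t. x t i) ` {0..T}) \<subseteq> D"
    using integral_solutionD(2)[OF sol] by auto
qed blast

lemma dist_Pair_le: "dist (a, b) (c, d) \<le> dist a c + dist b d"
  unfolding dist_Pair_Pair by (rule sqrt_sum_squares_le_sum) auto

locale string_field =
  fixes D :: "(real ^ 'k) set" and f :: "(real ^ 'k) \<times> (real ^ 'k) \<times> (real ^ 'k) \<Rightarrow> real ^ 'k"
  assumes lipf: "locally_lipschitz_on (D \<times> D \<times> D) f"
begin

lemma lipschitz_on_compact:
  assumes "compact C" "C \<subseteq> D"
  obtains L where "lipschitz_on L (C \<times> C \<times> C) f"
  by (rule locally_lipschitz_on_compact[OF lipf, of "C \<times> C \<times> C"])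
    (use assms that in \<open>auto intro: compact_Times\<close>)

lemma bounded_on_compact:
  assumes "compact C" "C \<subseteq> D"
  obtains M where "0 \<le> M" "\<And>z. z \<in> C \<times> C \<times> C \<Longrightarrow> norm (f z) \<le> M"
proof -
  obtain L where "lipschitz_on L (C \<times> C \<times> C) f" using lipschitz_on_compact[OF assms] .
  then have "compact (f ` (C \<times> C \<times> C))"
    by (intro compact_continuous_image lipschitz_on_continuous_on compact_Times assms(1))
  then obtain M where "\<And>z. z \<in> C \<times> C \<times> C \<Longrightarrow> norm (f z) \<le> M"
    by (meson compact_imp_bounded bounded_iff imageI)
  then show thesis using that[of "max M 0"] by fastforce
qed

text \<open>States and inputs stay in a compact subset of \<open>D\<close> up to a negligible set,
  so \<open>f\<close> is bounded along the solution, which is then Lipschitz in time. The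
  differential equation almost everywhere is Lebesgue differentiation of the integral.\<close>

lemma integral_solution_regular:
  assumes sol: "integral_solution D f n T u w \<xi> x"
    and C: "compact C" "C \<subseteq> D" and N: "negligible N"
    and uw: "\<And>t. t \<in> {0..T} - N \<Longrightarrow> u t \<in> C \<and> w t \<in> C"
  shows "i \<in> {1..n} \<Longrightarrow> absolutely_continuous_on {0..T} (\<lambda>t. x t i)"
    and "\<exists>N. negligible N \<and> (\<forall>i\<in>{1..n}. \<forall>t\<in>{0<..<T} - N.
           ((\<lambda>t. x t i) has_vector_derivative f (neighbours n u w x t i)) (at t))"
proof -
  obtain C1 where C1: "compact C1" "C1 \<subseteq> D" "\<And>t i. t \<in> {0..T} \<Longrightarrow> i \<in> {1..n} \<Longrightarrow> x t i \<in> C1"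
    by (rule integral_solution_compact_range[OF sol]) blast
  obtain M where M: "0 \<le> M" "\<And>z. z \<in> (C \<union> C1) \<times> (C \<union> C1) \<times> (C \<union> C1) \<Longrightarrow> norm (f z) \<le> M"
    using bounded_on_compact[of "C \<union> C1"] C C1 by blast
  show "absolutely_continuous_on {0..T} (\<lambda>t. x t i)" if i: "i \<in> {1..n}"
  proof (rule lipschitz_imp_absolutely_continuous_on[where M=M])
    fix a b assume ab: "a \<in> {0..T}" "b \<in> {0..T}" "a \<le> b"
    let ?f = "\<lambda>s. f (neighbours n u w x s i)"
    have ia: "(?f has_integral x a i - \<xi> i) {0..a}" and ib: "(?f has_integral x b i - \<xi> i) {0..b}"
      using integral_solutionD(3)[OF sol i] ab by auto
    have "?f integrable_on {a..b}"
      by (rule integrable_on_subinterval[OF has_integral_integrable[OF ib]]) (use ab in auto)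
    then have "(?f has_integral integral {a..b} ?f) {a..b}" by (rule integrable_integral)
    moreover have "integral {a..b} ?f = x b i - x a i"
      using Henstock_Kurzweil_Integration.integral_combine[OF _ ab(3) has_integral_integrable[OF ib]]
        integral_unique[OF ia] integral_unique[OF ib] ab by (auto simp: algebra_simps)
    ultimately have "(?f has_integral x b i - x a i) {a..b}" by simp
    \<comment> \<open>On \<open>N\<close> the inputs may lie outside \<open>C\<close>, where
      \<open>M\<close> gives no bound; setting the integrand to 0 there leaves the integral
      unchanged.\<close>
    then have spiked: "((\<lambda>s. if s \<in> N then 0 else ?f s) has_integral x b i - x a i) {a..b}"
      by (rule has_integral_spike[OF N, rotated]) auto
    have "norm (if s \<in> N then 0 else ?f s) \<le> M" if s: "s \<in> {a..b} - {}" for s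
    proof (cases "s \<in> N")
      case False
      then have "s \<in> {0..T}" "s \<notin> N" using s ab by auto
      then have "neighbours n u w x s i \<in> (C \<union> C1) \<times> (C \<union> C1) \<times> (C \<union> C1)"
        using uw[of s] C1(3)[of s] i by (intro neighbours_mem) auto
      then show ?thesis using M(2) False by simp
    qed (use M(1) in simp)
    from has_integral_bound_real[OF M(1) finite.emptyI spiked this] show "norm (x b i - x a i) \<le> M * (b - a)"
      using ab by simp
  qed
  have "\<exists>N. negligible N \<and> (\<forall>t\<in>{0<..<T} - N.
           ((\<lambda>t. x t i) has_vector_derivative f (neighbours n u w x t i)) (at t))" if i: "i \<in> {1..n}" for i
  proof (cases "T > 0")
    case True
    let ?f = "\<lambda>s. f (neighbours n u w x s i)"
    have "?f integrable_on {0..T}"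
      using integral_solutionD(3)[OF sol i, of T] True by auto
    then obtain N where N: "negligible N"
      "\<And>t. t \<in> {0<..<T} - N \<Longrightarrow> ((\<lambda>t. integral {0..t} ?f) has_vector_derivative ?f t) (at t)"
      using integral_has_vector_derivative_ae by blast
    have "((\<lambda>t. x t i) has_vector_derivative ?f t) (at t)" if t: "t \<in> {0<..<T} - N" for t
    proof (rule has_vector_derivative_transform_within_open[of "\<lambda>t. \<xi> i + integral {0..t} ?f"])
      show "((\<lambda>t. \<xi> i + integral {0..t} ?f) has_vector_derivative ?f t) (at t)"
        using N(2)[OF t] by (auto intro!: derivative_eq_intros)
      show "\<xi> i + integral {0..s} ?f = x s i" if "s \<in> {0<..<T}" for s
        using integral_unique[OF integral_solutionD(3)[OF sol i]] that by auto
    qed (use t in auto)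
    then show ?thesis using N(1) by blast
  qed (auto intro: exI[of _ "{}"])
  then obtain N' where N': "\<And>i. i \<in> {1..n} \<Longrightarrow> negligible (N' i)"
    "\<And>i t. i \<in> {1..n} \<Longrightarrow> t \<in> {0<..<T} - N' i \<Longrightarrow>
       ((\<lambda>t. x t i) has_vector_derivative f (neighbours n u w x t i)) (at t)" by metis
  show "\<exists>N. negligible N \<and> (\<forall>i\<in>{1..n}. \<forall>t\<in>{0<..<T} - N.
           ((\<lambda>t. x t i) has_vector_derivative f (neighbours n u w x t i)) (at t))"
    using N' by (intro exI[of _ "\<Union>i\<in>{1..n}. N' i"] conjI negligible_Union) auto
qed

text \<open>\<open>f\<close> is Lipschitz on the compact \<open>C \<times> C \<times> C\<close>, and
  a globally Lipschitz extension fits the Picard theory. Curves that stay in \<open>C\<close> cannot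
  distinguish \<open>f'\<close> from \<open>f\<close>.\<close>

lemma extended_family:
  assumes C: "compact C" "C \<subseteq> D" and T: "0 \<le> T"
    and uw: "\<And>t. u t \<in> C" "\<And>t. w t \<in> C"
    and mu: "u \<in> borel_measurable (lebesgue_on {0..T})" and mw: "w \<in> borel_measurable (lebesgue_on {0..T})"
  obtains f' L where "\<And>z. z \<in> C \<times> C \<times> C \<Longrightarrow> f' z = f z"
    "lipschitz_family (\<lambda>s y i. f' (neighbours n u w (\<lambda>_. y) s i)) {1..n} T L"
proof -
  obtain L where "lipschitz_on L (C \<times> C \<times> C) f" using lipschitz_on_compact[OF C] .
  then obtain M f' where M: "lipschitz_on M UNIV f'" and f': "\<And>z. z \<in> C \<times> C \<times> C \<Longrightarrow> f' z = f z"
    using lipschitz_on_extend by blast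
  have M0: "0 \<le> M" using M lipschitz_on_nonneg by blast
  have cont: "continuous_on A f'" for A using lipschitz_on_continuous_on[OF M] continuous_on_subset by blast
  \<comment> \<open>Each of the three entries of \<open>neighbours\<close> moves by at most
    \<open>B\<close>, and the product distance is at most the sum of the three; adding 1 keeps the
    constant positive when \<open>M = 0\<close>.\<close>
  have "lipschitz_family (\<lambda>s y i. f' (neighbours n u w (\<lambda>_. y) s i)) {1..n} T (3 * (M + 1))"
  proof
    fix y :: "real \<Rightarrow> nat \<Rightarrow> real ^ 'k" and i
    assume i: "i \<in> {1..n}" and y: "\<And>j. j \<in> {1..n} \<Longrightarrow> continuous_on {0..T} (\<lambda>t. y t j)"
    have eq: "neighbours n u w (\<lambda>_. y s) s i = neighbours n u w y s i" for s
      by (rule neighbours_cong) (use i in auto)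
    have "(\<lambda>s. with_boundary n u w y s j) \<in> borel_measurable (lebesgue_on {0..T})" if "j \<le> n + 1" for j
    proof (cases "j \<in> {1..n}")
      case True
      then show ?thesis
        using y by (auto simp: with_boundary_def intro: continuous_imp_measurable_on_sets_lebesgue)
    qed (use that mu mw in \<open>auto simp: with_boundary_def\<close>)
    note wb = this
    have "(\<lambda>s. neighbours n u w y s i) \<in> borel_measurable (lebesgue_on {0..T})"
      unfolding neighbours_def by (intro borel_measurable_Pair wb) (use i in auto)
    then have meas: "(\<lambda>s. f' (neighbours n u w y s i)) \<in> borel_measurable (lebesgue_on {0..T})"
      by (rule measurable_compose[OF _ borel_measurable_continuous_onI[OF cont]])
    \<comment> \<open>\<open>y\<close> is an arbitrary continuous curve and may leave
      \<open>C\<close>; adding its range gives a compact set on which the continuous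
      \<open>f'\<close> is bounded.\<close>
    define C1 where "C1 = C \<union> (\<Union>j\<in>{1..n}. (\<lambda>t. y t j) ` {0..T})"
    have "compact C1" unfolding C1_def
      using y C(1) by (intro compact_Un compact_UN compact_continuous_image) auto
    then have "compact (f' ` (C1 \<times> C1 \<times> C1))" by (intro compact_continuous_image cont compact_Times)
    then obtain B where B: "\<And>z. z \<in> C1 \<times> C1 \<times> C1 \<Longrightarrow> norm (f' z) \<le> B"
      by (meson compact_imp_bounded bounded_iff imageI)
    have "integrable (lebesgue_on {0..T}) (\<lambda>s. f' (neighbours n u w y s i))"
    proof (rule integrable_bounded_measurable_Icc[OF meas AE_I2])
      fix s assume "s \<in> space (lebesgue_on {0..T})"
      then have "y s j \<in> C1" if "j \<in> {1..n}" for j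
        using that unfolding C1_def by (intro UnI2 UN_I[of j] imageI) auto
      then show "norm (f' (neighbours n u w y s i)) \<le> B"
        using uw i by (intro B neighbours_mem) (auto simp: C1_def)
    qed
    then show "(\<lambda>s. f' (neighbours n u w (\<lambda>_. y s) s i)) integrable_on {0..T}"
      unfolding eq by (rule integrable_on_lebesgue_on) simp
  next
    fix s :: real and y z :: "nat \<Rightarrow> real ^ 'k" and i B
    assume i: "i \<in> {1..n}" and yz: "\<And>j. j \<in> {1..n} \<Longrightarrow> norm (y j - z j) \<le> B"
    have "0 \<le> B" using yz[OF i] norm_ge_zero order_trans by blast
    have d: "dist (with_boundary n u w (\<lambda>_. y) s j) (with_boundary n u w (\<lambda>_. z) s j) \<le> B" if "j \<le> n + 1" for j
      using yz[of j] \<open>0 \<le> B\<close> that by (auto simp: with_boundary_def dist_norm)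
    have "dist (a, b, c) (a', b', c') \<le> dist a a' + (dist b b' + dist c c')" for a b c a' b' c' :: "real ^ 'k"
      using dist_Pair_le[of a "(b, c)" a' "(b', c')"] dist_Pair_le[of b c b' c'] by linarith
    then have "dist (neighbours n u w (\<lambda>_. y) s i) (neighbours n u w (\<lambda>_. z) s i) \<le> B + (B + B)"
      unfolding neighbours_def by (rule order_trans) (use i in \<open>intro add_mono d; auto\<close>)
    then have "M * dist (neighbours n u w (\<lambda>_. y) s i) (neighbours n u w (\<lambda>_. z) s i) \<le> M * (3 * B)"
      using M0 by (intro mult_left_mono) auto
    also have "\<dots> \<le> 3 * (M + 1) * B" using \<open>0 \<le> B\<close> by (simp add: algebra_simps)
    finally show "norm (f' (neighbours n u w (\<lambda>_. y) s i) - f' (neighbours n u w (\<lambda>_. z) s i)) \<le> 3 * (M + 1) * B"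
      using lipschitz_onD[OF M, of "neighbours n u w (\<lambda>_. y) s i" "neighbours n u w (\<lambda>_. z) s i"]
      by (simp add: dist_norm)
  qed (use T M0 in auto)
  then show thesis using that f' by blast
qed

text \<open>Both solutions and the truncated inputs lie in one compact \<open>C\<close>, so both
  solve the integral equation of the same extended family, where uniqueness is known.\<close>

lemma integral_solution_unique:
  assumes x: "integral_solution D f n T u w \<xi> x" and y: "integral_solution D f n T u w \<xi> y"
    and T: "0 \<le> T" and u: "u \<in> signals A" "0 \<in> A" "A \<subseteq> D" and w: "w \<in> signals B" "0 \<in> B" "B \<subseteq> D"
    and t: "t \<in> {0..T}" and i: "i \<in> {1..n}"
  shows "x t i = y t i"
proof -
  obtain Ku u' Nu where u': "compact Ku" "Ku \<subseteq> A" "\<And>t. u' t \<in> Ku"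
    "u' \<in> borel_measurable (lebesgue_on {0..T})" "negligible Nu" "\<And>t. t \<in> {0..T} - Nu \<Longrightarrow> u' t = u t"
    using signal_truncate[OF u(1,2), of T] by metis
  obtain Kw w' Nw where w': "compact Kw" "Kw \<subseteq> B" "\<And>t. w' t \<in> Kw"
    "w' \<in> borel_measurable (lebesgue_on {0..T})" "negligible Nw" "\<And>t. t \<in> {0..T} - Nw \<Longrightarrow> w' t = w t"
    using signal_truncate[OF w(1,2), of T] by metis
  obtain Cx where Cx: "compact Cx" "Cx \<subseteq> D" "\<And>t i. t \<in> {0..T} \<Longrightarrow> i \<in> {1..n} \<Longrightarrow> x t i \<in> Cx"
    by (rule integral_solution_compact_range[OF x]) blast
  obtain Cy where Cy: "compact Cy" "Cy \<subseteq> D" "\<And>t i. t \<in> {0..T} \<Longrightarrow> i \<in> {1..n} \<Longrightarrow> y t i \<in> Cy"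
    by (rule integral_solution_compact_range[OF y]) blast
  define C where "C = Ku \<union> Kw \<union> Cx \<union> Cy"
  have C: "compact C" "C \<subseteq> D"
    unfolding C_def using u' w' Cx Cy u(3) w(3) by (auto intro: compact_Un)
  have uw: "u' t \<in> C" "w' t \<in> C" for t using u'(3) w'(3) by (auto simp: C_def)
  obtain f' L where f': "\<And>z. z \<in> C \<times> C \<times> C \<Longrightarrow> f' z = f z"
    and fam: "lipschitz_family (\<lambda>s y i. f' (neighbours n u' w' (\<lambda>_. y) s i)) {1..n} T L"
    using extended_family[OF C T uw u'(4) w'(4)] by metis
  have eq: "z s j = \<xi> j + integral {0..s} (\<lambda>t. f' (neighbours n u' w' (\<lambda>_. z t) t j))"
    if z: "integral_solution D f n T u w \<xi> z" and zC: "\<And>t i. t \<in> {0..T} \<Longrightarrow> i \<in> {1..n} \<Longrightarrow> z t i \<in> C"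
      and j: "j \<in> {1..n}" and s: "s \<in> {0..T}" for z s j
  proof -
    have "f' (neighbours n u' w' (\<lambda>_. z t) t j) = f (neighbours n u w z t j)" if "t \<in> {0..s} - (Nu \<union> Nw)" for t
    proof -
      have t: "t \<in> {0..T}" "t \<notin> Nu" "t \<notin> Nw" using that s by auto
      have 1: "neighbours n u' w' (\<lambda>_. z t) t j = neighbours n u' w' z t j"
        by (rule neighbours_cong) (use j in auto)
      have "neighbours n u' w' z t j \<in> C \<times> C \<times> C" by (rule neighbours_mem) (use uw zC t j in auto)
      moreover have "neighbours n u' w' z t j = neighbours n u w z t j"
        by (rule neighbours_cong) (use u'(6) w'(6) t j in auto)
      ultimately show ?thesis using f' 1 by simp
    qed
    then have "((\<lambda>t. f' (neighbours n u' w' (\<lambda>_. z t) t j)) has_integral z s j - \<xi> j) {0..s}"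
      using u'(5) w'(5) by (intro has_integral_spike[OF _ _ integral_solutionD(3)[OF z j s], of "Nu \<union> Nw"]) auto
    from integral_unique[OF this] show ?thesis by simp
  qed
  show ?thesis
    by (rule lipschitz_family.integral_solution_unique[OF fam, of x \<xi> y, OF _ _ _ _ i t])
      (use integral_solutionD(1)[OF x] integral_solutionD(1)[OF y] eq[OF x] eq[OF y] Cx(3) Cy(3) in \<open>auto simp: C_def\<close>)
qed

text \<open>Solutions on growing horizons agree on their overlaps by uniqueness, so they glue to one
  curve. Regularity is then collected from each bounded horizon, with countably many exceptional
  sets.\<close>

lemma string_solution_of_integral_solutions:
  assumes \<xi>: "\<xi> \<in> Dpow D n" and u: "u \<in> signals A" "0 \<in> A" "A \<subseteq> D" and w: "w \<in> signals B" "0 \<in> B" "B \<subseteq> D"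
    and ex: "\<And>T. 0 < T \<Longrightarrow> \<exists>x. integral_solution D f n T u w \<xi> x"
  obtains x where "string_solution D f n u w \<xi> x"
proof -
  have "\<exists>x. integral_solution D f n (real N + 1) u w \<xi> x" for N by (rule ex) simp
  then obtain X where X: "\<And>N. integral_solution D f n (real N + 1) u w \<xi> (X N)" by metis
  \<comment> \<open>At time \<open>t\<close> the solution with index
    \<open>nat \<lceil>t\<rceil>\<close> is used, whose horizon exceeds \<open>t\<close>. The
    restriction makes \<open>x t\<close> undefined outside \<open>{1..n}\<close>, as membership in
    \<open>Dpow D n\<close> demands.\<close>
  define x where "x t = (\<lambda>i\<in>{1..n}. X (nat \<lceil>t\<rceil>) t i)" for t
  have sol: "integral_solution D f n (real N + 1) u w \<xi> x" for N
  proof (rule integral_solution_cong[OF X[of N]])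
    fix t i assume t: "t \<in> {0..real N + 1}" and i: "i \<in> {1..n}"
    define M where "M = min (real N + 1) (real (nat \<lceil>t\<rceil>) + 1)"
    have "t \<le> real N + 1" "0 \<le> t" using t by simp_all
    moreover have "t \<le> real (nat \<lceil>t\<rceil>)" by (rule real_nat_ceiling_ge)
    ultimately have "t \<le> M" unfolding M_def by (intro min.boundedI) linarith+
    then have M: "t \<in> {0..M}" "0 \<le> M" using \<open>0 \<le> t\<close> by simp_all
    have 1: "integral_solution D f n M u w \<xi> (X N)"
      by (rule integral_solution_mono[OF X]) (simp add: M_def)
    have 2: "integral_solution D f n M u w \<xi> (X (nat \<lceil>t\<rceil>))"
      by (rule integral_solution_mono[OF X]) (simp add: M_def)
    have "X N t i = X (nat \<lceil>t\<rceil>) t i"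
      by (rule integral_solution_unique[OF 1 2 M(2) u w M(1) i])
    then show "X N t i = x t i" using i by (simp add: x_def)
  qed
  have solT: "integral_solution D f n T u w \<xi> x" for T
    by (rule integral_solution_mono[OF sol[of "nat \<lceil>T\<rceil>"]]) (use real_nat_ceiling_ge[of T] in linarith)
  have reg: "(\<forall>i\<in>{1..n}. absolutely_continuous_on {0..T} (\<lambda>t. x t i)) \<and>
      (\<exists>N. negligible N \<and> (\<forall>i\<in>{1..n}. \<forall>t\<in>{0<..<T} - N.
           ((\<lambda>t. x t i) has_vector_derivative f (neighbours n u w x t i)) (at t)))" for T
  proof -
    obtain Ku u' Nu where u': "compact Ku" "Ku \<subseteq> A" "\<And>t. u' t \<in> Ku" "negligible Nu" "\<And>t. t \<in> {0..T} - Nu \<Longrightarrow> u' t = u t"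
      using signal_truncate[OF u(1,2), of T] by metis
    obtain Kw w' Nw where w': "compact Kw" "Kw \<subseteq> B" "\<And>t. w' t \<in> Kw" "negligible Nw" "\<And>t. t \<in> {0..T} - Nw \<Longrightarrow> w' t = w t"
      using signal_truncate[OF w(1,2), of T] by metis
    have C: "compact (Ku \<union> Kw)" "Ku \<union> Kw \<subseteq> D" "negligible (Nu \<union> Nw)"
      using u' w' u w by auto
    have uw: "u t \<in> Ku \<union> Kw \<and> w t \<in> Ku \<union> Kw" if "t \<in> {0..T} - (Nu \<union> Nw)" for t
      using u'(3,5)[of t] w'(3,5)[of t] that by auto
    show ?thesis using integral_solution_regular[OF solT[of T] C uw] by blast
  qed
  have "\<forall>k::nat. \<exists>N. negligible N \<and> (\<forall>i\<in>{1..n}. \<forall>t\<in>{0<..<real k} - N.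
           ((\<lambda>t. x t i) has_vector_derivative f (neighbours n u w x t i)) (at t))"
    using reg by blast
  then obtain N where N: "\<And>k::nat. negligible (N k)"
    "\<And>k i t. i \<in> {1..n} \<Longrightarrow> t \<in> {0<..<real k} - N k \<Longrightarrow>
           ((\<lambda>t. x t i) has_vector_derivative f (neighbours n u w x t i)) (at t)" by metis
  have "string_solution D f n u w \<xi> x"
    unfolding string_solution_def
  proof (intro conjI allI ballI impI)
    show "x 0 = \<xi>"
    proof
      fix i show "x 0 i = \<xi> i"
      proof (cases "i \<in> {1..n}")
        case True
        show ?thesis by (rule integral_solution_initial[OF solT[of 0] True]) simp
      next
        case False
        then have "x 0 i = undefined" unfolding x_def by (simp only: restrict_def if_False)
        then show ?thesis using PiE_arb[OF \<xi> False] by simp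
      qed
    qed
    show "x t \<in> Dpow D n" if "t \<ge> 0" for t
    proof (rule PiE_I)
      fix i assume "i \<in> {1..n}"
      then show "x t i \<in> D" by (rule integral_solutionD(2)[OF solT[of t]]) (use that in simp)
    next
      fix i assume "i \<notin> {1..n}"
      then show "x t i = undefined" unfolding x_def by (simp only: restrict_def if_False)
    qed
    show "absolutely_continuous_on {0..T} (\<lambda>t. x t i)" if "i \<in> {1..n}" for i T
      using reg[of T] that by blast
    fix i assume i: "i \<in> {1..n}"
    \<comment> \<open>Time 0 is excluded as well: the derivative is two-sided and was obtained only
      in open intervals starting at 0.\<close>
    have "negligible ({0} \<union> (\<Union>k. N k))" 
      using N(1) by (intro negligible_Un negligible_countable_Union) auto
    moreover have "((\<lambda>s. x s i) has_vector_derivative f (neighbours n u w x t i)) (at t)"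
      if t: "t \<in> {0..} - ({0} \<union> (\<Union>k. N k))" for t
    proof -
      obtain k where "t < real k" using reals_Archimedean2 by blast
      then show ?thesis using N(2)[OF i, of t k] t by auto
    qed
    ultimately show "AE t in lebesgue_on {0..}. ((\<lambda>s. x s i) has_vector_derivative
             f (with_boundary n u w x t (i - 1), with_boundary n u w x t i, with_boundary n u w x t (i + 1))) (at t)"
      unfolding neighbours_def by (subst AE_lebesgue_on_iff_negligible) (simp, blast)
  qed
  then show thesis using that by blast
qed

end

section \<open>The dissipation inequality\<close>

locale string_lyapunov = string_field D f
  for D :: "(real ^ 'k) set" and f +
  fixes \<Omega> S :: "(real ^ 'k) set" and h :: "real ^ 'k \<Rightarrow> real ^ 'm" and V :: "real ^ 'k \<Rightarrow> real"
    and g r :: "(real ^ 'k) \<times> (real ^ 'k) \<Rightarrow> real" and p c \<sigma> \<omega> \<Gamma>\<^sub>1 \<Gamma>\<^sub>2 :: real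
  assumes openD: "open D"
    and sub: "\<Omega> \<subseteq> D" "S \<subseteq> D" "0 \<in> \<Omega>" "0 \<in> S"
    and conth: "continuous_on D h"
    and p: "1 \<le> p"
    and V: "C1_on D V" "\<And>x. x \<in> D \<Longrightarrow> 0 \<le> V x"
    and nonneg: "0 \<le> \<sigma>" "0 \<le> \<omega>" "0 \<le> \<Gamma>\<^sub>1" "0 \<le> \<Gamma>\<^sub>2" "0 < c"
    and diss: "\<And>x u w. x \<in> D \<Longrightarrow> u \<in> D \<Longrightarrow> w \<in> D \<Longrightarrow>
           gradient V x \<bullet> f (u, x, w) \<le> - c * norm (h x) powr p + g (u, x) + r (x, w)"
    and rg: "\<And>x w. x \<in> D \<Longrightarrow> w \<in> D \<Longrightarrow>
           r (x, w) + g (x, w) \<le> c * \<sigma> * norm (h x) powr p + c * \<omega> * norm (h w) powr p"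
    and g\<Omega>: "\<And>x u. x \<in> D \<Longrightarrow> u \<in> \<Omega> \<Longrightarrow>
           g (u, x) \<le> \<Gamma>\<^sub>1 * norm (h u) powr p + c * \<omega> * norm (h x) powr p"
    and rS: "\<And>x w. x \<in> D \<Longrightarrow> w \<in> S \<Longrightarrow>
           r (x, w) \<le> c * \<sigma> * norm (h x) powr p + \<Gamma>\<^sub>2 * norm (h w) powr p"
    and small: "\<sigma> + \<omega> < 1"
begin

definition H :: "real ^ 'k \<Rightarrow> real" where "H x = norm (h x) powr p"

text \<open>The part of the dissipation rate \<open>c\<close> that survives the coupling, positive
  by \<open>small\<close>.\<close>

definition \<kappa> :: real where "\<kappa> = c * (1 - \<sigma> - \<omega>)"

lemma \<kappa>_pos: "0 < \<kappa>" unfolding \<kappa>_def using nonneg small by simp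

lemma H_nonneg: "0 \<le> H x" by (simp add: H_def)

lemma continuous_on_V: "continuous_on D V"
  using V(1) unfolding C1_on_def
  by (meson continuous_at_imp_continuous_on differentiable_imp_continuous_within)

lemma continuous_on_H: "continuous_on D H"
  unfolding H_def using p by (intro continuous_on_powr' continuous_intros conth) auto

text \<open>The cross terms \<open>r (x\<^sub>i, x\<^sub>i\<^sub>+\<^sub>1) + g (x\<^sub>i, x\<^sub>i\<^sub>+\<^sub>1)\<close> pair up along the string.\<close>

lemma sum_gradient_le:
  fixes y :: "nat \<Rightarrow> real ^ 'k"
  assumes "n \<ge> 1" and D: "\<And>j. j \<le> n + 1 \<Longrightarrow> y j \<in> D" and "y 0 \<in> \<Omega>" "y (n + 1) \<in> S"
  shows "(\<Sum>i=1..n. gradient V (y i) \<bullet> f (y (i - 1), y i, y (i + 1)))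
    \<le> \<Gamma>\<^sub>1 * H (y 0) + \<Gamma>\<^sub>2 * H (y (n + 1)) - \<kappa> * (\<Sum>i=1..n. H (y i))"
proof -
  \<comment> \<open>\<open>m\<close> counts the links between two nodes of the string; the two
    remaining links lead to the inputs.\<close>
  obtain m where n: "n = Suc m" using assms(1) by (cases n) auto
  have "(\<Sum>i=1..n. gradient V (y i) \<bullet> f (y (i - 1), y i, y (i + 1)))
      \<le> (\<Sum>i=1..n. - c * H (y i) + g (y (i - 1), y i) + r (y i, y (i + 1)))"
    unfolding H_def by (intro sum_mono diss D) auto
  also have "\<dots> = - c * (\<Sum>i=1..n. H (y i)) + (\<Sum>i=1..n. g (y (i - 1), y i)) + (\<Sum>i=1..n. r (y i, y (i + 1)))"
    by (simp only: sum.distrib sum_distrib_left)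
  also have "(\<Sum>i=1..n. g (y (i - 1), y i)) = g (y 0, y 1) + (\<Sum>i=1..m. g (y i, y (i + 1)))"
    using sum.atLeast_Suc_atMost[of 1 n "\<lambda>i. g (y (i - 1), y i)"]
      sum.shift_bounds_cl_Suc_ivl[of "\<lambda>i. g (y (i - 1), y i)" 1 m] n by simp
  also have "(\<Sum>i=1..n. r (y i, y (i + 1))) = (\<Sum>i=1..m. r (y i, y (i + 1))) + r (y n, y (n + 1))"
    using n by simp
  finally have 1: "(\<Sum>i=1..n. gradient V (y i) \<bullet> f (y (i - 1), y i, y (i + 1)))
      \<le> - c * (\<Sum>i=1..n. H (y i)) + g (y 0, y 1) + r (y n, y (n + 1))
        + (\<Sum>i=1..m. r (y i, y (i + 1)) + g (y i, y (i + 1)))"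
    by (simp add: sum.distrib)
  have "(\<Sum>i=1..m. r (y i, y (i + 1)) + g (y i, y (i + 1))) \<le> (\<Sum>i=1..m. c * \<sigma> * H (y i) + c * \<omega> * H (y (i + 1)))"
    unfolding H_def by (intro sum_mono rg D) (use n in auto)
  also have "\<dots> = c * \<sigma> * (\<Sum>i=1..m. H (y i)) + c * \<omega> * (\<Sum>i=1..m. H (y (i + 1)))"
    by (simp add: sum.distrib sum_distrib_left)
  finally have 2: "(\<Sum>i=1..m. r (y i, y (i + 1)) + g (y i, y (i + 1)))
      \<le> c * \<sigma> * (\<Sum>i=1..m. H (y i)) + c * \<omega> * (\<Sum>i=1..m. H (y (i + 1)))" .
  have 3: "g (y 0, y 1) \<le> \<Gamma>\<^sub>1 * H (y 0) + c * \<omega> * H (y 1)"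
    unfolding H_def by (rule g\<Omega>) (use D assms n in auto)
  have 4: "r (y n, y (n + 1)) \<le> c * \<sigma> * H (y n) + \<Gamma>\<^sub>2 * H (y (n + 1))"
    unfolding H_def by (rule rS) (use D assms n in auto)
  \<comment> \<open>The inner links give \<sigma>-terms at nodes 1 to \<open>m\<close> and
    \<omega>-terms at nodes 2 to \<open>n\<close>. The missing \<sigma>-term at \<open>n\<close> and
    \<omega>-term at 1 come from facts \<open>4\<close> and \<open>3\<close>, so both families add
    up to the full sum.\<close>
  have 5: "(\<Sum>i=1..n. H (y i)) = (\<Sum>i=1..m. H (y i)) + H (y n)" using n by simp
  have 6: "(\<Sum>i=1..n. H (y i)) = H (y 1) + (\<Sum>i=1..m. H (y (i + 1)))"
    using sum.atLeast_Suc_atMost[of 1 n "\<lambda>i. H (y i)"]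
      sum.shift_bounds_cl_Suc_ivl[of "\<lambda>i. H (y i)" 1 m] n by simp
  have "c * \<sigma> * (\<Sum>i=1..n. H (y i)) = c * \<sigma> * (\<Sum>i=1..m. H (y i)) + c * \<sigma> * H (y n)"
    unfolding 5 by (simp add: algebra_simps)
  moreover have "c * \<omega> * (\<Sum>i=1..n. H (y i)) = c * \<omega> * H (y 1) + c * \<omega> * (\<Sum>i=1..m. H (y (i + 1)))"
    unfolding 6 by (simp add: algebra_simps)
  moreover have "\<kappa> * (\<Sum>i=1..n. H (y i)) = c * (\<Sum>i=1..n. H (y i)) - c * \<sigma> * (\<Sum>i=1..n. H (y i))
      - c * \<omega> * (\<Sum>i=1..n. H (y i))"
    by (simp add: \<kappa>_def algebra_simps)
  ultimately show ?thesis using 1 2 3 4 by linarith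
qed

text \<open>\<open>V\<close> is Lipschitz on the compact range of each component, so the total
  storage is absolutely continuous, and the chain rule holds off \<open>N\<close>. The derivative
  bound \<open>\<phi>\<close> is integrated directly, so only \<open>\<phi>\<close> has to be
  integrable, not the derivative of the storage.\<close>

lemma energy_estimate:
  assumes "n \<ge> 1" "0 \<le> T"
    and D: "\<And>i t. i \<in> {1..n} \<Longrightarrow> t \<in> {0..T} \<Longrightarrow> x t i \<in> D"
    and ac: "\<And>i. i \<in> {1..n} \<Longrightarrow> absolutely_continuous_on {0..T} (\<lambda>t. x t i)"
    and N: "negligible N"
    and der: "\<And>i t. i \<in> {1..n} \<Longrightarrow> t \<in> {0<..<T} - N \<Longrightarrow>
        ((\<lambda>t. x t i) has_vector_derivative f (neighbours n u w x t i)) (at t)"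
    and u: "\<And>t. t \<in> {0..T} \<Longrightarrow> u t \<in> \<Omega>" "(\<lambda>t. H (u t)) integrable_on {0..T}"
    and w: "\<And>t. t \<in> {0..T} \<Longrightarrow> w t \<in> S" "(\<lambda>t. H (w t)) integrable_on {0..T}"
  shows "(\<Sum>i=1..n. V (x T i)) + \<kappa> * (\<Sum>i=1..n. integral {0..T} (\<lambda>t. H (x t i)))
    \<le> (\<Sum>i=1..n. V (x 0 i)) + \<Gamma>\<^sub>1 * integral {0..T} (\<lambda>t. H (u t)) + \<Gamma>\<^sub>2 * integral {0..T} (\<lambda>t. H (w t))"
proof -
  have cont: "continuous_on {0..T} (\<lambda>t. x t i)" if "i \<in> {1..n}" for i
    by (rule absolutely_continuous_on_imp_continuous_on[OF ac[OF that]])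
  have intH: "(\<lambda>t. H (x t i)) integrable_on {0..T}" if i: "i \<in> {1..n}" for i
    by (intro integrable_continuous_interval continuous_on_compose2[OF continuous_on_H cont[OF i]]) (use D i in auto)
  have acV: "absolutely_continuous_on {0..T} (\<lambda>t. V (x t i))" if i: "i \<in> {1..n}" for i
  proof -
    have "compact ((\<lambda>t. x t i) ` {0..T})" by (intro compact_continuous_image cont i) simp
    moreover have "(\<lambda>t. x t i) ` {0..T} \<subseteq> D" using D i by auto
    ultimately obtain L where "lipschitz_on L ((\<lambda>t. x t i) ` {0..T}) V"
      using locally_lipschitz_on_compact[OF C1_on_imp_locally_lipschitz_on[OF openD V(1)]] by metis
    from absolutely_continuous_on_lipschitz_compose[OF ac[OF i] this] show ?thesis by simp
  qed
  define \<phi> where "\<phi> t = \<Gamma>\<^sub>1 * H (u t) + \<Gamma>\<^sub>2 * H (w t) - \<kappa> * (\<Sum>i=1..n. H (x t i))" for t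
  have \<phi>: "(\<phi> has_integral \<Gamma>\<^sub>1 * integral {0..T} (\<lambda>t. H (u t)) + \<Gamma>\<^sub>2 * integral {0..T} (\<lambda>t. H (w t))
      - \<kappa> * (\<Sum>i=1..n. integral {0..T} (\<lambda>t. H (x t i)))) {0..T}"
    unfolding \<phi>_def
    by (intro has_integral_diff has_integral_add has_integral_mult_right has_integral_sum integrable_integral u(2) w(2) intH) auto
  let ?W = "\<lambda>t. \<Sum>i=1..n. V (x t i)"
  have "?W T - ?W 0 \<le> integral {0..T} \<phi>"
  proof (rule absolutely_continuous_diff_le_integral[OF \<open>0 \<le> T\<close> _ N])
    show "absolutely_continuous_on {0..T} ?W" by (intro absolutely_continuous_on_sum acV)
    fix t assume t: "t \<in> {0<..<T} - N"
    let ?y = "with_boundary n u w x t"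
    have t': "t \<in> {0..T}" using t by auto
    have yi: "?y i = x t i" if "i \<in> {1..n}" for i using that by simp
    show "(?W has_real_derivative (\<Sum>i=1..n. gradient V (?y i) \<bullet> f (?y (i - 1), ?y i, ?y (i + 1)))) (at t)"
    proof (rule DERIV_sum)
      fix i assume i: "i \<in> {1..n}"
      have "((\<lambda>t. x t i) has_derivative (\<lambda>s. s *\<^sub>R f (neighbours n u w x t i))) (at t)"
        using der[OF i t] by (simp add: has_vector_derivative_def)
      moreover have "(V has_derivative (\<lambda>v. gradient V (x t i) \<bullet> v)) (at (x t i))"
        using V(1) D[OF i t'] by (intro has_derivative_gradient) (auto simp: C1_on_def)
      ultimately have "((\<lambda>t. V (x t i)) has_derivative (\<lambda>s. gradient V (x t i) \<bullet> (s *\<^sub>R f (neighbours n u w x t i)))) (at t)"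
        by (rule has_derivative_compose)
      then show "((\<lambda>t. V (x t i)) has_real_derivative gradient V (?y i) \<bullet> f (?y (i - 1), ?y i, ?y (i + 1))) (at t)"
        unfolding has_field_derivative_def yi[OF i] neighbours_def by (simp add: mult_commute_abs)
    qed
    have "?y j \<in> D" if "j \<le> n + 1" for j
      using that u(1)[OF t'] w(1)[OF t'] sub D t' by (intro with_boundary_mem) auto
    then have "(\<Sum>i=1..n. gradient V (?y i) \<bullet> f (?y (i - 1), ?y i, ?y (i + 1)))
        \<le> \<Gamma>\<^sub>1 * H (?y 0) + \<Gamma>\<^sub>2 * H (?y (n + 1)) - \<kappa> * (\<Sum>i=1..n. H (?y i))"
      using u(1)[OF t'] w(1)[OF t'] by (intro sum_gradient_le \<open>n \<ge> 1\<close>) auto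
    also have "\<dots> = \<phi> t" unfolding \<phi>_def using yi by simp
    finally show "(\<Sum>i=1..n. gradient V (?y i) \<bullet> f (?y (i - 1), ?y i, ?y (i + 1))) \<le> \<phi> t" .
  qed (use \<phi> in auto)
  then show ?thesis using integral_unique[OF \<phi>] by simp
qed

section \<open>Integrability of the outputs and the \<open>Lp\<close> estimate\<close>

lemma measurable_H:
  assumes "u \<in> borel_measurable (lebesgue_on {0..T})" "\<And>t. t \<in> {0..T} \<Longrightarrow> u t \<in> D"
  shows "(\<lambda>t. H (u t)) \<in> borel_measurable (lebesgue_on {0..T})"
proof -
  \<comment> \<open>\<open>H\<close> is known to be continuous only on \<open>D\<close>, so the
    composition goes through the subspace.\<close>
  have "u \<in> lebesgue_on {0..T} \<rightarrow>\<^sub>M restrict_space borel D"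
    using assms by (intro measurable_restrict_space2) auto
  moreover have "H \<in> restrict_space borel D \<rightarrow>\<^sub>M borel"
    by (rule borel_measurable_continuous_on_restrict[OF continuous_on_H])
  ultimately show ?thesis by (rule measurable_compose)
qed

lemma compact_bound_H:
  assumes "compact K" "K \<subseteq> D"
  obtains B where "0 \<le> B" "\<And>x. x \<in> K \<Longrightarrow> H x \<le> B"
proof -
  have "compact (H ` K)"
    using assms by (intro compact_continuous_image continuous_on_subset[OF continuous_on_H])
  then obtain B where "\<And>x. x \<in> K \<Longrightarrow> norm (H x) \<le> B"
    by (meson compact_imp_bounded bounded_iff imageI)
  then show thesis using that[of "max B 0"] by fastforce
qed

lemma signal_integrable_H:
  assumes u: "u \<in> signals A" and "A \<subseteq> D"
  shows "integrable (lebesgue_on {0..T}) (\<lambda>t. H (u t))"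
proof -
  obtain K where K: "compact K" "K \<subseteq> A" "AE t in lebesgue_on {0..T}. u t \<in> K"
    using signal_compact[OF u] by blast
  obtain B where B: "\<And>x. x \<in> K \<Longrightarrow> H x \<le> B" using compact_bound_H K \<open>A \<subseteq> D\<close> by (metis order_trans)
  have "u t \<in> D" if "t \<in> {0..T}" for t using u that \<open>A \<subseteq> D\<close> by (auto simp: signals_def)
  then show ?thesis
    using K(3) B H_nonneg
    by (intro integrable_bounded_measurable_Icc[where B=B] measurable_H signal_measurable[OF u])
      (auto elim!: eventually_mono)
qed

text \<open>\<open>Lp_norm\<close> uses the Lebesgue integral, the energy inequality the gauge
  integral; for integrable functions they agree.\<close>

lemma Lp_norm_eq:
  assumes "integrable (lebesgue_on {0..t}) (\<lambda>s. H (y s))"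
  shows "Lp_norm p t (\<lambda>s. h (y s)) = integral {0..t} (\<lambda>s. H (y s)) powr (1 / p)"
  using lebesgue_integral_eq_integral[OF assms] unfolding Lp_norm_def H_def by simp

text \<open>In the energy inequality the storage at time \<open>t\<close> and the output integrals
  of the other components are nonnegative and are dropped. After division by \<kappa>, two uses of
  subadditivity of the power \<open>1 / p\<close> separate the inputs and the initial
  storage.\<close>

lemma string_solution_estimate:
  assumes n: "n \<ge> 1" and u: "u \<in> signals \<Omega>" and w: "w \<in> signals S"
    and sol: "string_solution D f n u w \<xi> x" and t: "0 \<le> t" and i: "i \<in> {1..n}"
  shows "Lp_norm p t (\<lambda>s. h (x s i)) \<le> (\<Gamma>\<^sub>1 / \<kappa>) powr (1 / p) * Lp_norm p t (\<lambda>s. h (u s))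
     + (\<Gamma>\<^sub>2 / \<kappa>) powr (1 / p) * Lp_norm p t (\<lambda>s. h (w s))
     + (1 / \<kappa> * (\<Sum>i=1..n. V (\<xi> i))) powr (1 / p)"
proof -
  have x0: "x 0 = \<xi>" and D: "\<And>s j. 0 \<le> s \<Longrightarrow> j \<in> {1..n} \<Longrightarrow> x s j \<in> D"
    using sol unfolding string_solution_def by (auto simp: PiE_iff)
  have ac: "absolutely_continuous_on {0..t} (\<lambda>s. x s j)" if "j \<in> {1..n}" for j
  proof -
    \<comment> \<open>\<open>string_solution\<close> gives absolute continuity for positive horizons
      only, while \<open>t\<close> may be 0.\<close>
    have "absolutely_continuous_on {0..t+1} (\<lambda>s. x s j)"
      using sol that t unfolding string_solution_def by auto
    then show ?thesis by (rule absolutely_continuous_on_subset) auto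
  qed
  have "\<exists>N. negligible N \<and> (\<forall>s\<in>{0..} - N.
      ((\<lambda>s. x s j) has_vector_derivative f (neighbours n u w x s j)) (at s))" if "j \<in> {1..n}" for j
  proof -
    have "{0::real..} \<in> sets lebesgue" by simp
    from AE_lebesgue_on_iff_negligible[OF this] show ?thesis
      using sol that unfolding string_solution_def neighbours_def by blast
  qed
  then obtain N where N: "\<And>j. j \<in> {1..n} \<Longrightarrow> negligible (N j)"
    "\<And>j s. j \<in> {1..n} \<Longrightarrow> s \<in> {0..} - N j \<Longrightarrow>
      ((\<lambda>s. x s j) has_vector_derivative f (neighbours n u w x s j)) (at s)" by metis
  have N': "negligible (\<Union>j\<in>{1..n}. N j)" using N(1) by (intro negligible_Union) auto
  have uD: "u s \<in> \<Omega>" "w s \<in> S" if "0 \<le> s" for s using u w that by (auto simp: signals_def)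
  have iu: "integrable (lebesgue_on {0..t}) (\<lambda>s. H (u s))" and iw: "integrable (lebesgue_on {0..t}) (\<lambda>s. H (w s))"
    using signal_integrable_H u w sub by auto
  have ix: "integrable (lebesgue_on {0..t}) (\<lambda>s. H (x s j))" if j: "j \<in> {1..n}" for j
  proof -
    have "continuous_on {0..t} (\<lambda>s. H (x s j))"
      by (rule continuous_on_compose2[OF continuous_on_H absolutely_continuous_on_imp_continuous_on[OF ac[OF j]]])
        (use D j in auto)
    then show ?thesis by (rule continuous_imp_integrable_real)
  qed
  let ?I = "\<lambda>y. integral {0..t} (\<lambda>s. H (y s))"
  have pos: "0 \<le> ?I y" if "integrable (lebesgue_on {0..t}) (\<lambda>s. H (y s))" for y
    using that H_nonneg by (intro integral_nonneg integrable_on_lebesgue_on) auto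
  have "(\<Sum>j=1..n. V (x t j)) + \<kappa> * (\<Sum>j=1..n. ?I (\<lambda>s. x s j))
      \<le> (\<Sum>j=1..n. V (x 0 j)) + \<Gamma>\<^sub>1 * ?I u + \<Gamma>\<^sub>2 * ?I w"
    using N(2) D uD iu iw t n
    by (intro energy_estimate[OF _ _ _ ac N'] integrable_on_lebesgue_on) auto
  moreover have "0 \<le> (\<Sum>j=1..n. V (x t j))" using D t V(2) by (intro sum_nonneg) auto
  moreover have "\<kappa> * ?I (\<lambda>s. x s i) \<le> \<kappa> * (\<Sum>j=1..n. ?I (\<lambda>s. x s j))"
    using \<kappa>_pos i ix pos by (intro mult_left_mono member_le_sum) auto
  ultimately have "\<kappa> * ?I (\<lambda>s. x s i) \<le> (\<Sum>j=1..n. V (\<xi> j)) + \<Gamma>\<^sub>1 * ?I u + \<Gamma>\<^sub>2 * ?I w"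
    unfolding x0 by linarith
  then have le: "?I (\<lambda>s. x s i) \<le> \<Gamma>\<^sub>1 / \<kappa> * ?I u + \<Gamma>\<^sub>2 / \<kappa> * ?I w + 1 / \<kappa> * (\<Sum>j=1..n. V (\<xi> j))"
    using \<kappa>_pos by (simp add: field_simps)
  have "0 \<le> (\<Sum>j=1..n. V (\<xi> j))" using D[of 0] x0 V(2) by (intro sum_nonneg) auto
  then have c0: "0 \<le> 1 / \<kappa> * (\<Sum>j=1..n. V (\<xi> j))" using \<kappa>_pos by simp
  have ab0: "0 \<le> \<Gamma>\<^sub>1 / \<kappa> * ?I u" "0 \<le> \<Gamma>\<^sub>2 / \<kappa> * ?I w" "0 \<le> \<Gamma>\<^sub>1 / \<kappa>" "0 \<le> \<Gamma>\<^sub>2 / \<kappa>"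
    using \<kappa>_pos nonneg pos[OF iu] pos[OF iw] by auto
  have "?I (\<lambda>s. x s i) powr (1 / p)
      \<le> (\<Gamma>\<^sub>1 / \<kappa> * ?I u + \<Gamma>\<^sub>2 / \<kappa> * ?I w + 1 / \<kappa> * (\<Sum>j=1..n. V (\<xi> j))) powr (1 / p)"
    using le pos[OF ix[OF i]] p by (intro powr_mono2) auto
  also have "\<dots> \<le> (\<Gamma>\<^sub>1 / \<kappa> * ?I u) powr (1 / p) + (\<Gamma>\<^sub>2 / \<kappa> * ?I w) powr (1 / p)
      + (1 / \<kappa> * (\<Sum>j=1..n. V (\<xi> j))) powr (1 / p)"
  proof -
    have "0 < 1 / p" "1 / p \<le> 1" using p by auto
    then show ?thesis
      using powr_add_le[of "\<Gamma>\<^sub>1 / \<kappa> * ?I u + \<Gamma>\<^sub>2 / \<kappa> * ?I w" "1 / \<kappa> * (\<Sum>j=1..n. V (\<xi> j))" "1 / p"]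
        powr_add_le[OF ab0(1,2), of "1 / p"] c0 ab0(1,2) by linarith
  qed
  also have "(\<Gamma>\<^sub>1 / \<kappa> * ?I u) powr (1 / p) = (\<Gamma>\<^sub>1 / \<kappa>) powr (1 / p) * ?I u powr (1 / p)"
    by (rule powr_mult)
  also have "(\<Gamma>\<^sub>2 / \<kappa> * ?I w) powr (1 / p) = (\<Gamma>\<^sub>2 / \<kappa>) powr (1 / p) * ?I w powr (1 / p)"
    by (rule powr_mult)
  finally show ?thesis by (simp add: Lp_norm_eq iu iw ix[OF i])
qed

section \<open>Forward completeness\<close>

text \<open>Here the output integrals are dropped from the energy inequality and the storage is
  kept. Each input integral is at most \<open>T * B\<close>, so the bound involves initial data,
  horizon and inputs but not the solution.\<close>

lemma integral_solution_V_bound: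
  assumes n: "n \<ge> 1" and sol: "integral_solution D f n T u w \<xi> x"
    and Ku: "compact Ku" "Ku \<subseteq> \<Omega>" and Kw: "compact Kw" "Kw \<subseteq> S"
    and uw: "\<And>t. u t \<in> Ku" "\<And>t. w t \<in> Kw"
    and mu: "u \<in> borel_measurable (lebesgue_on {0..T})" and mw: "w \<in> borel_measurable (lebesgue_on {0..T})"
    and B: "0 \<le> B" "\<And>z. z \<in> Ku \<union> Kw \<Longrightarrow> H z \<le> B"
    and t: "t \<in> {0..T}" and i: "i \<in> {1..n}"
  shows "V (x t i) \<le> (\<Sum>j=1..n. V (\<xi> j)) + (\<Gamma>\<^sub>1 + \<Gamma>\<^sub>2) * (T * B)"
proof -
  have t0: "0 \<le> t" "0 \<le> T" using t by auto
  have sol_t: "integral_solution D f n t u w \<xi> x" using integral_solution_mono[OF sol] t by auto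
  have C: "compact (Ku \<union> Kw)" "Ku \<union> Kw \<subseteq> D" using Ku Kw sub by auto
  have uwC: "u s \<in> Ku \<union> Kw \<and> w s \<in> Ku \<union> Kw" for s using uw by auto
  note reg = integral_solution_regular[OF sol_t C negligible_empty uwC]
  obtain N where N: "negligible N" "\<And>i s. i \<in> {1..n} \<Longrightarrow> s \<in> {0<..<t} - N \<Longrightarrow>
           ((\<lambda>t. x t i) has_vector_derivative f (neighbours n u w x s i)) (at s)"
    using reg(2) by blast
  have int: "(\<lambda>s. H (v s)) integrable_on {0..t} \<and> integral {0..t} (\<lambda>s. H (v s)) \<le> T * B
      \<and> 0 \<le> integral {0..t} (\<lambda>s. H (v s))"
    if m: "v \<in> borel_measurable (lebesgue_on {0..T})" and v: "\<And>s. v s \<in> Ku \<union> Kw" for v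
  proof -
    have "v \<in> borel_measurable (lebesgue_on {0..t})"
      by (rule measurable_restrict_mono[OF m]) (use t in auto)
    then have "(\<lambda>s. H (v s)) \<in> borel_measurable (lebesgue_on {0..t})"
      by (rule measurable_H) (use v C(2) in blast)
    then have "integrable (lebesgue_on {0..t}) (\<lambda>s. H (v s))"
      by (rule integrable_bounded_measurable_Icc[where B=B]) (use B(2) v H_nonneg in auto)
    then have i: "(\<lambda>s. H (v s)) integrable_on {0..t}" by (rule integrable_on_lebesgue_on) simp
    have "integral {0..t} (\<lambda>s. H (v s)) \<le> integral {0..t} (\<lambda>s. B)"
      by (intro integral_le i integrable_const_ivl B(2) v)
    also have "\<dots> = t * B" using t0 by simp
    also have "\<dots> \<le> T * B" using t B(1) by (intro mult_right_mono) auto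
    finally show ?thesis using i H_nonneg by (auto intro: integral_nonneg)
  qed
  note iu = int[OF mu conjunct1[OF uwC]] and iw = int[OF mw conjunct2[OF uwC]]
  have D: "x s j \<in> D" if "j \<in> {1..n}" "s \<in> {0..t}" for s j using integral_solutionD(2)[OF sol_t that] .
  \<comment> \<open>A function that is not integrable has integral 0 by convention, so the sign
    holds for every \<open>j\<close>.\<close>
  have Hx: "0 \<le> integral {0..t} (\<lambda>s. H (x s j))" for j
    using H_nonneg by (cases "(\<lambda>s. H (x s j)) integrable_on {0..t}")
      (simp_all add: integral_nonneg not_integrable_integral)
  have "(\<Sum>j=1..n. V (x t j)) + \<kappa> * (\<Sum>j=1..n. integral {0..t} (\<lambda>s. H (x s j)))
      \<le> (\<Sum>j=1..n. V (x 0 j)) + \<Gamma>\<^sub>1 * integral {0..t} (\<lambda>s. H (u s)) + \<Gamma>\<^sub>2 * integral {0..t} (\<lambda>s. H (w s))"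
  proof (rule energy_estimate[OF n t0(1) D reg(1) N])
    show "u s \<in> \<Omega>" "w s \<in> S" for s using uw Ku(2) Kw(2) by blast+
  qed (use iu iw in blast)+
  moreover have "V (x t i) \<le> (\<Sum>j=1..n. V (x t j))"
    using i t0 V(2) D by (intro member_le_sum) auto
  moreover have "0 \<le> \<kappa> * (\<Sum>j=1..n. integral {0..t} (\<lambda>s. H (x s j)))"
    using \<kappa>_pos Hx by (intro mult_nonneg_nonneg sum_nonneg) auto
  moreover have "(\<Sum>j=1..n. V (x 0 j)) = (\<Sum>j=1..n. V (\<xi> j))"
    using integral_solution_initial[OF sol _ t0(2)] by (intro sum.cong) auto
  moreover have "\<Gamma>\<^sub>1 * integral {0..t} (\<lambda>s. H (u s)) \<le> \<Gamma>\<^sub>1 * (T * B)" "\<Gamma>\<^sub>2 * integral {0..t} (\<lambda>s. H (w s)) \<le> \<Gamma>\<^sub>2 * (T * B)"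
    using iu iw nonneg by (simp_all add: mult_left_mono)
  ultimately show ?thesis by (simp add: distrib_right)
qed

text \<open>A priori bounds confine every solution to a compact set \<open>K\<close>. We solve instead for a globally
  Lipschitz field \<open>f'\<close> which agrees with \<open>f\<close> near \<open>K\<close>; by a continuity argument its solution never
  leaves \<open>K\<close>, where the two fields agree.\<close>

lemma integral_solution_exists:
  assumes sublevel: "\<And>\<rho>. 0 < \<rho> \<Longrightarrow> compact {\<xi> \<in> D. V \<xi> \<le> \<rho> \<and> norm \<xi> \<le> \<rho>}"
    and bdd: "\<And>\<rho>. 0 < \<rho> \<Longrightarrow> bounded (f ` ({\<xi> \<in> D. V \<xi> \<le> \<rho>} \<times> {\<xi> \<in> D. V \<xi> \<le> \<rho>} \<times> {\<xi> \<in> D. V \<xi> \<le> \<rho>}))"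
    and n: "n \<ge> 1" and \<xi>: "\<And>i. i \<in> {1..n} \<Longrightarrow> \<xi> i \<in> D"
    and u: "u \<in> signals \<Omega>" and w: "w \<in> signals S" and T: "0 < T"
  shows "\<exists>x. integral_solution D f n T u w \<xi> x"
proof -
  obtain Ku u' Nu where u': "compact Ku" "Ku \<subseteq> \<Omega>" "\<And>t. u' t \<in> Ku"
    "u' \<in> borel_measurable (lebesgue_on {0..T})" "negligible Nu" "\<And>t. t \<in> {0..T} - Nu \<Longrightarrow> u' t = u t"
    using signal_truncate[OF u sub(3), of T] by metis
  obtain Kw w' Nw where w': "compact Kw" "Kw \<subseteq> S" "\<And>t. w' t \<in> Kw"
    "w' \<in> borel_measurable (lebesgue_on {0..T})" "negligible Nw" "\<And>t. t \<in> {0..T} - Nw \<Longrightarrow> w' t = w t"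
    using signal_truncate[OF w sub(4), of T] by metis
  have uw_comp: "compact (Ku \<union> Kw)" "Ku \<union> Kw \<subseteq> D" using u' w' sub by auto
  obtain B where B: "0 \<le> B" "\<And>z. z \<in> Ku \<union> Kw \<Longrightarrow> H z \<le> B" using compact_bound_H[OF uw_comp] by metis
  have "compact (V ` (Ku \<union> Kw))"
    by (intro compact_continuous_image uw_comp(1) continuous_on_subset[OF continuous_on_V uw_comp(2)])
  then obtain BV where BV: "\<And>z. z \<in> Ku \<union> Kw \<Longrightarrow> norm (V z) \<le> BV"
    by (meson compact_imp_bounded bounded_iff imageI)
  \<comment> \<open>1 keeps \<rho> positive, \<open>BV\<close> puts the input values into
    \<open>\<Phi>\<close> along with the states, and the last entry is the a priori bound on
    \<open>V\<close>.\<close>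
  define \<rho> where "\<rho> = max 1 (max BV ((\<Sum>j=1..n. V (\<xi> j)) + (\<Gamma>\<^sub>1 + \<Gamma>\<^sub>2) * (T * B)))"
  define \<Phi> where "\<Phi> = {\<xi> \<in> D. V \<xi> \<le> \<rho>}"
  have "0 < \<rho>" by (simp add: \<rho>_def)
  have \<rho>: "(\<Sum>j=1..n. V (\<xi> j)) + (\<Gamma>\<^sub>1 + \<Gamma>\<^sub>2) * (T * B) \<le> \<rho>" by (simp add: \<rho>_def)
  have uw\<Phi>: "Ku \<union> Kw \<subseteq> \<Phi>" using BV uw_comp(2) by (fastforce simp: \<Phi>_def \<rho>_def)
  obtain M where M: "\<And>z. z \<in> \<Phi> \<times> \<Phi> \<times> \<Phi> \<Longrightarrow> norm (f z) \<le> M"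
    using bdd[OF \<open>0 < \<rho>\<close>] unfolding \<Phi>_def[symmetric] bounded_iff by blast
  define M' where "M' = max M 0"
  have M': "0 \<le> M'" "\<And>z. z \<in> \<Phi> \<times> \<Phi> \<times> \<Phi> \<Longrightarrow> norm (f z) \<le> M'" using M by (force simp: M'_def)+
  \<comment> \<open>Initial norms plus the distance covered in time \<open>T\<close> at speed at
    most \<open>M'\<close>; taking the maximum lets one number bound both \<open>V\<close> and the
    norm.\<close>
  define R where "R = max \<rho> ((\<Sum>j=1..n. norm (\<xi> j)) + M' * T)"
  define K where "K = {\<xi> \<in> D. V \<xi> \<le> R \<and> norm \<xi> \<le> R}"
  have "compact K" unfolding K_def using sublevel[of R] \<open>0 < \<rho>\<close> by (simp add: R_def)
  have "K \<subseteq> D" by (auto simp: K_def)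
  have \<xi>K: "\<xi> i \<in> K" if i: "i \<in> {1..n}" for i
  proof -
    have "V (\<xi> i) \<le> (\<Sum>j=1..n. V (\<xi> j))" using i V(2) \<xi> by (intro member_le_sum) auto
    moreover have "norm (\<xi> i) \<le> (\<Sum>j=1..n. norm (\<xi> j))" using i by (intro member_le_sum) auto
    moreover have "0 \<le> (\<Gamma>\<^sub>1 + \<Gamma>\<^sub>2) * (T * B)" "0 \<le> M' * T" using nonneg T B M' by auto
    ultimately show ?thesis using \<xi>[OF i] \<rho> by (auto simp: K_def R_def)
  qed
  \<comment> \<open>A collar around \<open>K\<close> inside \<open>D\<close>. The trajectory may
    wander through it before it is known to stay in \<open>K\<close>: the compact \<open>K'\<close>
    keeps \<open>f\<close> Lipschitz, the open \<open>U\<close> serves the first-exit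
    argument.\<close>
  obtain e where e: "e > 0" "(\<Union>z\<in>K. cball z e) \<subseteq> D"
    using compact_subset_open_imp_cball_epsilon_subset[OF \<open>compact K\<close> openD \<open>K \<subseteq> D\<close>] .
  define K' where "K' = (\<Union>z\<in>K. cball z e)"
  define U where "U = (\<Union>z\<in>K. ball z e)"
  have "compact K'"
  proof -
    have "K' = {z + v | z v. z \<in> K \<and> v \<in> cball 0 e}"
      unfolding K'_def by (auto simp: dist_norm) (metis add_diff_cancel_left' add.commute diff_add_cancel norm_minus_commute)+
    then show ?thesis using compact_sums[OF \<open>compact K\<close> compact_cball[of 0 e]] by simp
  qed
  have "K' \<subseteq> D" using e(2) by (simp add: K'_def)
  have U: "open U" "K \<subseteq> U" "U \<subseteq> K'" using e(1) by (auto simp: U_def K'_def)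
  define C where "C = Ku \<union> Kw \<union> K'"
  have C: "compact C" "C \<subseteq> D"
    unfolding C_def using u'(1) w'(1) uw_comp(2) \<open>compact K'\<close> \<open>K' \<subseteq> D\<close> by auto
  have uwC: "u' t \<in> C" "w' t \<in> C" for t using u'(3) w'(3) by (auto simp: C_def)
  obtain f' L where f': "\<And>z. z \<in> C \<times> C \<times> C \<Longrightarrow> f' z = f z"
    and fam: "lipschitz_family (\<lambda>s y i. f' (neighbours n u' w' (\<lambda>_. y) s i)) {1..n} T L"
    by (rule extended_family[OF C less_imp_le[OF T] uwC u'(4) w'(4)]) blast
  interpret fam: lipschitz_family "\<lambda>s y i. f' (neighbours n u' w' (\<lambda>_. y) s i)" "{1..n}" T L by (rule fam)
  obtain x where cont: "\<And>j. j \<in> {1..n} \<Longrightarrow> continuous_on {0..T} (\<lambda>t. x t j)"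
    and x: "\<And>j t. j \<in> {1..n} \<Longrightarrow> t \<in> {0..T} \<Longrightarrow>
        x t j = \<xi> j + integral {0..t} (\<lambda>s. f' (neighbours n u' w' (\<lambda>_. x s) s j))"
    by (rule fam.integral_solution_exists[of \<xi>]) blast
  have nb: "neighbours n u' w' (\<lambda>_. x s) s j = neighbours n u' w' x s j" if "j \<in> {1..n}" for s j
    by (rule neighbours_cong) (use that in auto)
  have sol: "integral_solution D f n t\<^sub>0 u' w' \<xi> x"
    if t0: "t\<^sub>0 \<in> {0..T}" and xK': "\<And>s i. s \<in> {0..t\<^sub>0} \<Longrightarrow> i \<in> {1..n} \<Longrightarrow> x s i \<in> K'" for t\<^sub>0
    unfolding integral_solution_def
  proof (intro ballI conjI)
    fix i assume i: "i \<in> {1..n}"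
    show "continuous_on {0..t\<^sub>0} (\<lambda>t. x t i)" by (rule continuous_on_subset[OF cont[OF i]]) (use t0 in auto)
    fix t assume t: "t \<in> {0..t\<^sub>0}"
    show "x t i \<in> D" using xK'[OF t i] \<open>K' \<subseteq> D\<close> by blast
    have "((\<lambda>s. f' (neighbours n u' w' (\<lambda>_. x s) s i)) has_integral x t i - \<xi> i) {0..t}"
      using integrable_integral[OF fam.int_sub[where y=x and t=t, OF i cont]] x[OF i, of t] t t0 by simp
    moreover have "f' (neighbours n u' w' (\<lambda>_. x s) s i) = f (neighbours n u' w' x s i)" if "s \<in> {0..t}" for s
    proof -
      have "neighbours n u' w' x s i \<in> C \<times> C \<times> C"
        by (rule neighbours_mem) (use uwC xK'[of s] that t i in \<open>auto simp: C_def\<close>)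
      then show ?thesis using f' nb[OF i] by simp
    qed
    ultimately show "((\<lambda>s. f (neighbours n u' w' x s i)) has_integral x t i - \<xi> i) {0..t}"
      by (rule has_integral_eq[rotated])
  qed
  \<comment> \<open>The bootstrap: a trajectory that has stayed in \<open>K'\<close> solves the
    equation for \<open>f\<close> itself, so the a priori bounds apply and place it in the smaller
    set \<open>K\<close>.\<close>
  have inK: "x t\<^sub>0 i \<in> K"
    if t0: "t\<^sub>0 \<in> {0..T}" and xK': "\<And>s i. s \<in> {0..t\<^sub>0} \<Longrightarrow> i \<in> {1..n} \<Longrightarrow> x s i \<in> K'" and i: "i \<in> {1..n}" for t\<^sub>0 i
  proof -
    note sol0 = sol[OF t0 xK']
    have m: "u' \<in> borel_measurable (lebesgue_on {0..t\<^sub>0})" "w' \<in> borel_measurable (lebesgue_on {0..t\<^sub>0})"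
      by (rule measurable_restrict_mono[OF u'(4)] measurable_restrict_mono[OF w'(4)]; use t0 in auto)+
    have "V (x s j) \<le> \<rho>" if "s \<in> {0..t\<^sub>0}" "j \<in> {1..n}" for s j
    proof -
      have "V (x s j) \<le> (\<Sum>j=1..n. V (\<xi> j)) + (\<Gamma>\<^sub>1 + \<Gamma>\<^sub>2) * (t\<^sub>0 * B)"
        by (rule integral_solution_V_bound[OF n sol0 u'(1,2) w'(1,2) u'(3) w'(3) m B that])
      also have "\<dots> \<le> (\<Sum>j=1..n. V (\<xi> j)) + (\<Gamma>\<^sub>1 + \<Gamma>\<^sub>2) * (T * B)"
        using t0 nonneg B(1) by (intro add_left_mono mult_left_mono mult_right_mono) auto
      finally show ?thesis using \<rho> by linarith
    qed
    then have x\<Phi>: "x s j \<in> \<Phi>" if "s \<in> {0..t\<^sub>0}" "j \<in> {1..n}" for s j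
      using that xK' \<open>K' \<subseteq> D\<close> unfolding \<Phi>_def by blast
    have bnd: "norm (f (neighbours n u' w' x s i)) \<le> M'" if "s \<in> {0..t\<^sub>0} - {}" for s
      using u'(3) w'(3) uw\<Phi> x\<Phi>[of s] that i by (intro M'(2) neighbours_mem) auto
    have "((\<lambda>s. f (neighbours n u' w' x s i)) has_integral x t\<^sub>0 i - \<xi> i) {0..t\<^sub>0}"
      using integral_solutionD(3)[OF sol0 i] t0 by auto
    from has_integral_bound_real[OF M'(1) finite.emptyI this bnd]
    have "norm (x t\<^sub>0 i - \<xi> i) \<le> M' * t\<^sub>0" using t0 by simp
    also have "\<dots> \<le> M' * T" using t0 M' by (intro mult_left_mono) auto
    finally have "norm (x t\<^sub>0 i) \<le> norm (\<xi> i) + M' * T"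
      using norm_triangle_ineq2[of "x t\<^sub>0 i" "\<xi> i"] by linarith
    moreover have "norm (\<xi> i) \<le> (\<Sum>j=1..n. norm (\<xi> j))" using i by (intro member_le_sum) auto
    moreover have "x t\<^sub>0 i \<in> \<Phi>" using x\<Phi>[of t\<^sub>0] i t0 by auto
    ultimately show ?thesis by (auto simp: K_def R_def \<Phi>_def)
  qed
  have x0: "x 0 i = \<xi> i" if "i \<in> {1..n}" for i using x[OF that, of 0] T by simp
  have xU: "x t i \<in> U" if "t \<in> {0..T}" "i \<in> {1..n}" for t i
  proof (rule ccontr)
    assume nU: "x t i \<notin> U"
    \<comment> \<open>\<open>U\<close> is open and the components are continuous, so the times
      outside \<open>U\<close> form a compact set, which has a first element
      \<open>t1\<close>.\<close>
    define Bad where "Bad = (\<Union>j\<in>{1..n}. {0..T} \<inter> (\<lambda>s. x s j) -` (- U))"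
    have "compact Bad" unfolding Bad_def
    proof (rule compact_UN)
      fix j assume "j \<in> {1..n}"
      have "closed ({0..T} \<inter> (\<lambda>s. x s j) -` (- U))"
        using U(1) by (intro continuous_closed_preimage cont \<open>j \<in> {1..n}\<close>) auto
      then show "compact ({0..T} \<inter> (\<lambda>s. x s j) -` (- U))"
        by (metis compact_Icc compact_Int_closed inf.left_idem)
    qed simp
    moreover have "t \<in> Bad"
      unfolding Bad_def by (rule UN_I[OF that(2)]) (use nU that(1) in simp)
    ultimately have "\<exists>t1\<in>Bad. \<forall>s\<in>Bad. t1 \<le> s" by (intro compact_attains_inf) auto
    then obtain t1 where t1: "t1 \<in> Bad" "\<And>s. s \<in> Bad \<Longrightarrow> t1 \<le> s" by blast
    have t1T: "t1 \<in> {0..T}" using t1(1) unfolding Bad_def by blast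
    have good: "x s j \<in> U" if "0 \<le> s" "s < t1" "j \<in> {1..n}" for s j
    proof (rule ccontr)
      assume "x s j \<notin> U"
      then have "s \<in> Bad" unfolding Bad_def by (intro UN_I[OF that(3)]) (use that t1T in simp)
      then show False using t1(2)[of s] that by simp
    qed
    obtain k where k: "k \<in> {1..n}" "x t1 k \<notin> U" using t1(1) unfolding Bad_def by blast
    then have "t1 \<noteq> 0" using x0[OF k(1)] \<xi>K[OF k(1)] U(2) by auto
    then have "0 < t1" using t1T by auto
    \<comment> \<open>Before \<open>t1\<close> all components are in \<open>U\<close>; by continuity
      they are in the closed \<open>K'\<close> at \<open>t1\<close> too. Then \<open>inK\<close>
      puts them into \<open>K\<close>, hence into \<open>U\<close>, against the choice of
      \<open>t1\<close>.\<close>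
    have "x s j \<in> K'" if s: "s \<in> {0..t1}" and j: "j \<in> {1..n}" for s j
    proof -
      have "(\<lambda>s. x s j) ` closure {0..<t1} \<subseteq> K'"
      proof (rule image_closure_subset)
        show "continuous_on (closure {0..<t1}) (\<lambda>s. x s j)"
          by (rule continuous_on_subset[OF cont[OF j]]) (use t1T \<open>0 < t1\<close> in auto)
        show "closed K'" using \<open>compact K'\<close> by (rule compact_imp_closed)
        show "(\<lambda>s. x s j) ` {0..<t1} \<subseteq> K'" using good[OF _ _ j] U(3) by auto
      qed
      then show ?thesis using s \<open>0 < t1\<close> by auto
    qed
    then have "x t1 k \<in> K" by (rule inK[OF t1T _ k(1)])
    then show False using k(2) U(2) by blast
  qed
  have sol': "integral_solution D f n T u' w' \<xi> x" by (rule sol) (use T xU U(3) in auto)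
  have "integral_solution D f n T u w \<xi> x"
    unfolding integral_solution_def
  proof (intro ballI conjI)
    fix i assume i: "i \<in> {1..n}"
    show "continuous_on {0..T} (\<lambda>t. x t i)" by (rule cont[OF i])
    fix t assume t: "t \<in> {0..T}"
    show "x t i \<in> D" by (rule integral_solutionD(2)[OF sol' i t])
    note h = integral_solutionD(3)[OF sol' i t]
    show "((\<lambda>s. f (neighbours n u w x s i)) has_integral x t i - \<xi> i) {0..t}"
    proof (rule has_integral_spike[OF _ _ h])
      show "negligible (Nu \<union> Nw)" using u' w' by simp
      fix s assume s: "s \<in> {0..t} - (Nu \<union> Nw)"
      then have "s \<in> {0..T} - Nu" "s \<in> {0..T} - Nw" using t by auto
      from u'(6)[OF this(1)] w'(6)[OF this(2)]
      have "neighbours n u' w' x s i = neighbours n u w x s i"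
        using i by (intro neighbours_cong) auto
      then show "f (neighbours n u w x s i) = f (neighbours n u' w' x s i)" by simp
    qed
  qed
  then show ?thesis by blast
qed

lemma forward_complete_of_compact_sublevels:
  assumes sublevel: "\<And>\<rho>. 0 < \<rho> \<Longrightarrow> compact {\<xi> \<in> D. V \<xi> \<le> \<rho> \<and> norm \<xi> \<le> \<rho>}"
    and bdd: "\<And>\<rho>. 0 < \<rho> \<Longrightarrow> bounded (f ` ({\<xi> \<in> D. V \<xi> \<le> \<rho>} \<times> {\<xi> \<in> D. V \<xi> \<le> \<rho>} \<times> {\<xi> \<in> D. V \<xi> \<le> \<rho>}))"
    and n: "n \<ge> 1"
  shows "forward_complete D \<Omega> S f n"
  unfolding forward_complete_def
proof (intro ballI)
  fix \<xi> u w assume \<xi>: "\<xi> \<in> Dpow D n" and u: "u \<in> signals \<Omega>" and w: "w \<in> signals S"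
  have "\<xi> i \<in> D" if "i \<in> {1..n}" for i using PiE_mem[OF \<xi> that] .
  then have "\<exists>x. integral_solution D f n T u w \<xi> x" if "0 < T" for T
    using integral_solution_exists[OF sublevel bdd n _ u w that] by blast
  then show "\<exists>x. string_solution D f n u w \<xi> x"
    by (rule string_solution_of_integral_solutions[OF \<xi> u sub(3,1) w sub(4,2)]) blast+
qed

section \<open>Assembling string stability\<close>

lemma continuous_on_Q:
  "continuous_on (Dpow D n) (\<lambda>\<xi>. (1 / \<kappa> * (\<Sum>i=1..n. V (\<xi> i))) powr (1 / p))"
proof -
  have "continuous_on (Dpow D n) (\<lambda>\<xi>. V (\<xi> i))" if "i \<in> {1..n}" for i
  proof (rule continuous_on_compose2[OF continuous_on_V])
    show "continuous_on (Dpow D n) (\<lambda>\<xi>. \<xi> i)"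
      by (rule continuous_on_subset[OF continuous_on_product_coordinates]) simp
    show "(\<lambda>\<xi>. \<xi> i) ` Dpow D n \<subseteq> D" using that by (auto simp: PiE_iff)
  qed
  \<comment> \<open>The base may vanish; the power stays continuous there because the base is
    nonnegative and \<open>1 / p\<close> is positive.\<close>
  then show ?thesis
    using p \<kappa>_pos V(2) by (intro continuous_on_powr' continuous_intros) (auto simp: PiE_iff intro!: divide_nonneg_pos sum_nonneg)
qed

text \<open>The gains are linear with slopes independent of \<open>n\<close>, so one pair serves all
  strings; only the offset varies with \<open>n\<close>.\<close>

lemma Lp_string_stable_of_forward_complete:
  assumes fc: "\<And>n. n \<ge> 1 \<Longrightarrow> forward_complete D \<Omega> S f n"
    and est: "\<And>n. n \<ge> 1 \<Longrightarrow> stability_estimate D \<Omega> S f h p n (\<lambda>s. A * s) (\<lambda>s. B * s)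
      (\<lambda>\<xi>. (1 / \<kappa> * (\<Sum>i=1..n. V (\<xi> i))) powr (1 / p))"
    and "0 \<le> A" "0 \<le> B"
  shows "Lp_string_stable D \<Omega> S f h p"
  unfolding Lp_string_stable_def
proof (rule exI[of _ "\<lambda>s. A * s"], rule exI[of _ "\<lambda>s. B * s"], intro conjI allI impI)
  fix n :: nat assume n: "n \<ge> 1"
  show "\<exists>Q. continuous_on (Dpow D n) Q \<and> (\<forall>\<xi>\<in>Dpow D n. 0 \<le> Q \<xi>)
      \<and> stability_estimate D \<Omega> S f h p n (\<lambda>s. A * s) (\<lambda>s. B * s) Q"
    using continuous_on_Q[of n] est[OF n]
    by (intro exI[of _ "\<lambda>\<xi>. (1 / \<kappa> * (\<Sum>i=1..n. V (\<xi> i))) powr (1 / p)"]) simp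
qed (use assms in \<open>auto intro!: continuous_intros mono_onI mult_left_mono\<close>)

end

theorem theorem4:
  fixes D \<Omega> S :: "(real ^ 'k) set"
    and h :: "real ^ 'k \<Rightarrow> real ^ 'm"
    and f :: "(real ^ 'k) \<times> (real ^ 'k) \<times> (real ^ 'k) \<Rightarrow> real ^ 'k"
    and V :: "real ^ 'k \<Rightarrow> real"
    and g r :: "(real ^ 'k) \<times> (real ^ 'k) \<Rightarrow> real"
    and p c \<sigma> \<omega> \<Gamma>\<^sub>1 \<Gamma>\<^sub>2 :: real
  assumes "open D" "0 \<in> D"
    and "\<Omega> \<subseteq> D" "S \<subseteq> D" "0 \<in> \<Omega>" "0 \<in> S"
    and "continuous_on D h" "h 0 = 0"
    and "locally_lipschitz_on (D \<times> D \<times> D) f"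
    and "1 \<le> p"
    and "C1_on D V" "\<forall>x\<in>D. 0 \<le> V x"
    and "continuous_on (D \<times> D) g" "continuous_on (D \<times> D) r"
    and "0 \<le> \<sigma>" "0 \<le> \<omega>" "0 \<le> \<Gamma>\<^sub>1" "0 \<le> \<Gamma>\<^sub>2" "0 < c"
    and "\<forall>x\<in>D. \<forall>u\<in>D. \<forall>w\<in>D.
           gradient V x \<bullet> f (u, x, w) \<le> - c * norm (h x) powr p + g (u, x) + r (x, w)"
    and "\<forall>x\<in>D. \<forall>w\<in>D.
           r (x, w) + g (x, w) \<le> c * \<sigma> * norm (h x) powr p + c * \<omega> * norm (h w) powr p"
    and "\<forall>x\<in>D. \<forall>u\<in>\<Omega>. g (u, x) \<le> \<Gamma>\<^sub>1 * norm (h u) powr p + c * \<omega> * norm (h x) powr p"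
    and "\<forall>x\<in>D. \<forall>w\<in>S. r (x, w) \<le> c * \<sigma> * norm (h x) powr p + \<Gamma>\<^sub>2 * norm (h w) powr p"
    and "\<sigma> + \<omega> < 1"
  defines "a\<^sub>1 \<equiv> \<lambda>s. (\<Gamma>\<^sub>1 / (c * (1 - \<sigma> - \<omega>))) powr (1 / p) * s"
    and "a\<^sub>2 \<equiv> \<lambda>s. (\<Gamma>\<^sub>2 / (c * (1 - \<sigma> - \<omega>))) powr (1 / p) * s"
    and "Q \<equiv> \<lambda>n \<xi>. (1 / (c * (1 - \<sigma> - \<omega>)) * (\<Sum>i=1..n. V (\<xi> i))) powr (1 / p)"
    and "\<Phi> \<equiv> \<lambda>\<rho>. {\<xi> \<in> D. V \<xi> \<le> \<rho>}"
  shows "((\<forall>n\<ge>1. forward_complete D \<Omega> S f n) \<longrightarrow>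
            Lp_string_stable D \<Omega> S f h p \<and>
            (\<forall>n\<ge>1. stability_estimate D \<Omega> S f h p n a\<^sub>1 a\<^sub>2 (Q n)))
       \<and> ((\<forall>\<rho>>0. compact {\<xi> \<in> D. V \<xi> \<le> \<rho> \<and> norm \<xi> \<le> \<rho>}) \<and>
          (\<forall>\<Omega>' S'. \<forall>\<rho>>0. compact \<Omega>' \<and> \<Omega>' \<subseteq> \<Omega> \<and> compact S' \<and> S' \<subseteq> S \<longrightarrow>
             bounded (f ` (\<Phi> \<rho> \<times> \<Phi> \<rho> \<times> \<Phi> \<rho>)) \<and>
             bounded (f ` (\<Omega>' \<times> \<Phi> \<rho> \<times> \<Phi> \<rho>)) \<and>
             bounded (f ` (\<Phi> \<rho> \<times> \<Phi> \<rho> \<times> S'))) \<longrightarrow>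
            Lp_string_stable D \<Omega> S f h p \<and>
            (\<forall>n\<ge>1. stability_estimate D \<Omega> S f h p n a\<^sub>1 a\<^sub>2 (Q n)))"
proof -
  interpret string_lyapunov D f \<Omega> S h V g r p c \<sigma> \<omega> \<Gamma>\<^sub>1 \<Gamma>\<^sub>2
    by unfold_locales (use assms in simp_all)
  have est: "stability_estimate D \<Omega> S f h p n a\<^sub>1 a\<^sub>2 (Q n)" if "n \<ge> 1" for n
    unfolding stability_estimate_def a\<^sub>1_def a\<^sub>2_def Q_def \<kappa>_def[symmetric]
    using string_solution_estimate[OF that] by blast
  have stable: "Lp_string_stable D \<Omega> S f h p" if "\<And>n. n \<ge> 1 \<Longrightarrow> forward_complete D \<Omega> S f n"
    by (rule Lp_string_stable_of_forward_complete[OF that est[unfolded a\<^sub>1_def a\<^sub>2_def Q_def \<kappa>_def[symmetric]]])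
      auto
  show ?thesis
  proof (rule conjI; rule impI)
    assume "\<forall>n\<ge>1. forward_complete D \<Omega> S f n"
    then show "Lp_string_stable D \<Omega> S f h p \<and> (\<forall>n\<ge>1. stability_estimate D \<Omega> S f h p n a\<^sub>1 a\<^sub>2 (Q n))"
      using stable est by blast
  next
    assume *: "(\<forall>\<rho>>0. compact {\<xi> \<in> D. V \<xi> \<le> \<rho> \<and> norm \<xi> \<le> \<rho>}) \<and>
          (\<forall>\<Omega>' S'. \<forall>\<rho>>0. compact \<Omega>' \<and> \<Omega>' \<subseteq> \<Omega> \<and> compact S' \<and> S' \<subseteq> S \<longrightarrow>
             bounded (f ` (\<Phi> \<rho> \<times> \<Phi> \<rho> \<times> \<Phi> \<rho>)) \<and>
             bounded (f ` (\<Omega>' \<times> \<Phi> \<rho> \<times> \<Phi> \<rho>)) \<and>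
             bounded (f ` (\<Phi> \<rho> \<times> \<Phi> \<rho> \<times> S')))"
    \<comment> \<open>Any admissible pair of compact input sets yields this bound; the empty sets
      are the simplest choice.\<close>
    have "bounded (f ` (\<Phi> \<rho> \<times> \<Phi> \<rho> \<times> \<Phi> \<rho>))" if "0 < \<rho>" for \<rho>
      using conjunct2[OF *, rule_format, of \<rho> "{}" "{}"] that by simp
    then have "forward_complete D \<Omega> S f n" if "n \<ge> 1" for n
      using * that unfolding \<Phi>_def by (intro forward_complete_of_compact_sublevels) simp_all
    then show "Lp_string_stable D \<Omega> S f h p \<and> (\<forall>n\<ge>1. stability_estimate D \<Omega> S f h p n a\<^sub>1 a\<^sub>2 (Q n))"
      using stable est by blast
  qed
qed

end
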